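(* Let $\mu$ be a probability distribution on $\mathbb{Z}_{\ge 0}$ with $\mu(0)>0$, $\mu(1)>0$ and $\mu(2)>0$. Let $(k_n)$ be a sequence of positive integers with $k_n\to\infty$ and $k_n=o(n)$ as $n\to\infty$. Let $T_n^{k_n}$ be a $\mu$-Bienaymé–Galton–Watson tree conditioned to have $n$ vertices and $k_n$ leaves. Let $d\ge 2$ be an integer. 1. If $k_n=o\left(n^{\frac{d-1}{d}}\right)$, then $$\mathbb{P}\left(\deg_{\max}(T_n^{k_n})\le d\right)\xrightarrow[n\to\infty]{}1.$$ 2. Let $c>0$. If $k_n\sim c\,n^{\frac{d-1}{d}}$ as $n\to\infty$, then $\phi_{d+1}(T_n^{k_n})$ converges in distribution, as $n\to\infty$, to $$\mathrm{Poi}\left(c^d\,\frac{\mu(d+1)\mu(1)^{d-1}}{\mu(2)^d}\right).$$ 3. If $k_n^d/n^{d-1}\to+\infty$ as $n\to\infty$, then for every $p\ge1$, $$\frac{n^{d-1}}{k_n^d}\,\phi_{d+1}\left(T_n^{k_n}\right)\xrightarrow[n\to\infty]{L^p}\frac{\mu(1)^{d-1}\mu(d+1)}{\mu(2)^d}.$$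
   Context: A tree means a rooted planar (ordered) tree. A vertex with no children is a leaf. For a finite tree $t$ and a vertex $u$ of $t$, $c_u(t)$ is the number of children of $u$ in $t$ (its outdegree); $\phi_i(t)$ is the number of vertices of $t$ having exactly $i$ children, and $\deg_{\max}(t)=\max_{u\in t}c_u(t)$. A $\mu$-Bienaymé–Galton–Watson (BGW) tree $T$ is the random rooted planar tree in which the numbers of children of the vertices are i.i.d. with law $\mu$; in particular $\mathbb{P}(T=\tau)=\prod_{u\in\tau}\mu(c_u(\tau))$ for every finite tree $\tau$. $T_n^{k_n}$ has the law of $T$ conditioned on the event that $T$ has $n$ vertices and $k_n$ leaves, and is considered for those $n$ for which this event has positive probability (this is the case for all $n$ large enough). $\mathrm{Poi}(\lambda)$ is the Poisson distribution with parameter $\lambda$, with $\mathrm{Poi}(0)$ the Dirac mass at $0$. Convergence in $L^p$ of $Z_n$ (possibly defined on different probability spaces) to a constant $z$ means $\mathbb{E}[|Z_n-z|^p]\to0$. *)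

theory Defs
  imports "HOL-Probability.Probability" "HOL-Library.Landau_Symbols"
begin

text \<open>
  Rooted planar trees, possibly infinite, are encoded in the Ulam-Harris way, as sets of words over
  the natural numbers: the empty word is the root and \<open>u @ [i]\<close> is the \<open>i\<close>-th child
  (counting from \<open>0\<close>) of \<open>u\<close>.
\<close>

type_synonym utree = "nat list set"

definition plane_tree :: "utree \<Rightarrow> bool" where
  "plane_tree t \<longleftrightarrow> [] \<in> t \<and>
     (\<forall>u i. u @ [i] \<in> t \<longrightarrow> u \<in> t \<and> (\<forall>j<i. u @ [j] \<in> t)) \<and>
     (\<forall>u\<in>t. finite {i. u @ [i] \<in> t})"

definition outdeg :: "utree \<Rightarrow> nat list \<Rightarrow> nat" where
  "outdeg t u = card {i. u @ [i] \<in> t}"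

definition num_outdeg :: "nat \<Rightarrow> utree \<Rightarrow> nat" where
  "num_outdeg i t = card {u\<in>t. outdeg t u = i}"

definition deg_max :: "utree \<Rightarrow> nat" where
  "deg_max t = Max (outdeg t ` t)"

text \<open>
  The underlying probability space carries i.i.d. numbers of children with law \<open>\<mu>\<close>, one for
  each word; only those attached to vertices of the tree are used. The tree is infinite with positive
  probability when \<open>\<mu>\<close> is supercritical.
\<close>

definition bgw_space :: "nat pmf \<Rightarrow> (nat list \<Rightarrow> nat) measure" where
  "bgw_space \<mu> = PiM UNIV (\<lambda>_. measure_pmf \<mu>)"

definition bgw_tree :: "(nat list \<Rightarrow> nat) \<Rightarrow> utree" where
  "bgw_tree \<omega> = {u. \<forall>v i w. u = v @ i # w \<longrightarrow> i < \<omega> v}"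

definition bgw_event :: "nat pmf \<Rightarrow> nat \<Rightarrow> nat \<Rightarrow> (nat list \<Rightarrow> nat) set" where
  "bgw_event \<mu> n k = {\<omega> \<in> space (bgw_space \<mu>).
     finite (bgw_tree \<omega>) \<and> card (bgw_tree \<omega>) = n \<and> num_outdeg 0 (bgw_tree \<omega>) = k}"

text \<open>
  The conditioned tree is the random variable \<^const>\<open>bgw_tree\<close> on the following space. It is a
  probability space when the conditioning event has positive probability; otherwise it is
  the null measure.
\<close>

definition bgw_cond :: "nat pmf \<Rightarrow> nat \<Rightarrow> nat \<Rightarrow> (nat list \<Rightarrow> nat) measure" where
  "bgw_cond \<mu> n k = uniform_measure (bgw_space \<mu>) (bgw_event \<mu> n k)"

text \<open>The library's \<^const>\<open>poisson_pmf\<close> is only meaningful for a positive rate.\<close>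

definition Poi :: "real \<Rightarrow> nat pmf" where
  "Poi r = (if r = 0 then return_pmf 0 else poisson_pmf r)"

lemma bgw_tree_snoc_iff: "u @ [i] \<in> bgw_tree \<omega> \<longleftrightarrow> u \<in> bgw_tree \<omega> \<and> i < \<omega> u"
proof
  assume *: "u @ [i] \<in> bgw_tree \<omega>"
  have "j < \<omega> v" if "u = v @ j # w" for v j w
    using * that unfolding bgw_tree_def by simp
  moreover have "i < \<omega> u" using * unfolding bgw_tree_def by blast
  ultimately show "u \<in> bgw_tree \<omega> \<and> i < \<omega> u" unfolding bgw_tree_def by blast
next
  assume *: "u \<in> bgw_tree \<omega> \<and> i < \<omega> u"
  have "j < \<omega> v" if "u @ [i] = v @ j # w" for v j w
  proof (cases w rule: rev_cases)
    case Nil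
    then show ?thesis using that * by simp
  next
    case (snoc w' x)
    then have "u = v @ j # w'" using that by simp
    then show ?thesis using * unfolding bgw_tree_def by blast
  qed
  then show "u @ [i] \<in> bgw_tree \<omega>" unfolding bgw_tree_def by blast
qed

lemma plane_tree_bgw_tree: "plane_tree (bgw_tree \<omega>)"
proof -
  have "[] \<in> bgw_tree \<omega>" by (simp add: bgw_tree_def)
  then show ?thesis by (auto simp: plane_tree_def bgw_tree_snoc_iff)
qed

lemma outdeg_bgw_tree: "u \<in> bgw_tree \<omega> \<Longrightarrow> outdeg (bgw_tree \<omega>) u = \<omega> u"
  by (simp add: outdeg_def bgw_tree_snoc_iff)

lemma prob_space_bgw_space: "prob_space (bgw_space \<mu>)"
  unfolding bgw_space_def by (intro prob_space_PiM measure_pmf.prob_space_axioms)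

lemma measurable_bgw_coord [measurable]: "(\<lambda>\<omega>. \<omega> u) \<in> bgw_space \<mu> \<rightarrow>\<^sub>M count_space UNIV"
proof -
  have "(\<lambda>\<omega>. \<omega> u) \<in> bgw_space \<mu> \<rightarrow>\<^sub>M measure_pmf \<mu>"
    unfolding bgw_space_def by (rule measurable_component_singleton) simp
  then show ?thesis by (simp cong: measurable_cong_sets)
qed

lemma pred_in_bgw_tree [measurable]: "Measurable.pred (bgw_space \<mu>) (\<lambda>\<omega>. u \<in> bgw_tree \<omega>)"
  unfolding bgw_tree_def mem_Collect_eq by measurable

lemma pred_outdeg_bgw_tree [measurable]:
  "Measurable.pred (bgw_space \<mu>) (\<lambda>\<omega>. u \<in> bgw_tree \<omega> \<and> outdeg (bgw_tree \<omega>) u = i)"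
proof -
  have "Measurable.pred (bgw_space \<mu>) (\<lambda>\<omega>. u \<in> bgw_tree \<omega> \<and> \<omega> u = i)" by measurable
  then show ?thesis by (simp add: outdeg_bgw_tree cong: conj_cong)
qed

lemma measurable_card_countable:
  fixes S :: "'a \<Rightarrow> ('b::countable) set"
  assumes [measurable]: "\<And>u. Measurable.pred M (\<lambda>x. u \<in> S x)"
  shows "(\<lambda>x. card (S x)) \<in> M \<rightarrow>\<^sub>M count_space UNIV"
proof -
  have "card (S x) = card (to_nat ` S x)" for x
    by (simp add: card_image inj_on_def)
  moreover have "(\<lambda>x. card (to_nat ` S x)) \<in> M \<rightarrow>\<^sub>M count_space UNIV"
  proof (rule measurable_card)
    fix i :: nat
    have "{x \<in> space M. i \<in> to_nat ` S x} = {x \<in> space M. \<exists>u. i = to_nat u \<and> u \<in> S x}"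
      by auto
    then show "{x \<in> space M. i \<in> to_nat ` S x} \<in> sets M" by simp
  qed
  ultimately show ?thesis by simp
qed

lemma measurable_num_outdeg_bgw_tree [measurable]:
  "(\<lambda>\<omega>. num_outdeg i (bgw_tree \<omega>)) \<in> bgw_space \<mu> \<rightarrow>\<^sub>M count_space UNIV"
  unfolding num_outdeg_def by (intro measurable_card_countable) (simp add: pred_outdeg_bgw_tree)

lemma measurable_card_bgw_tree [measurable]:
  "(\<lambda>\<omega>. card (bgw_tree \<omega>)) \<in> bgw_space \<mu> \<rightarrow>\<^sub>M count_space UNIV"
  by (intro measurable_card_countable) simp

lemma measurable_deg_max_bgw_tree [measurable]:
  "(\<lambda>\<omega>. deg_max (bgw_tree \<omega>)) \<in> bgw_space \<mu> \<rightarrow>\<^sub>M count_space UNIV"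
proof -
  have eq: "outdeg t ` t = {i. \<exists>u. u \<in> t \<and> outdeg t u = i}" for t by auto
  show ?thesis unfolding deg_max_def eq by measurable
qed

lemma sets_bgw_event [measurable]: "bgw_event \<mu> n k \<in> sets (bgw_space \<mu>)"
proof -
  have "finite (bgw_tree \<omega>) \<and> card (bgw_tree \<omega>) = n \<longleftrightarrow> card (bgw_tree \<omega>) = n \<and> n \<noteq> 0" for \<omega>
  proof -
    have "bgw_tree \<omega> \<noteq> {}" using plane_tree_bgw_tree[of \<omega>] by (auto simp: plane_tree_def)
    then show ?thesis using card_eq_0_iff by (metis card.infinite)
  qed
  then have "bgw_event \<mu> n k = {\<omega> \<in> space (bgw_space \<mu>).
      card (bgw_tree \<omega>) = n \<and> n \<noteq> 0 \<and> num_outdeg 0 (bgw_tree \<omega>) = k}"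
    unfolding bgw_event_def by (metis (mono_tags, opaque_lifting))
  then show ?thesis by simp
qed

end

theory Submission
  imports Defs "HOL-Library.Sublist"
begin

text \<open>
  In depth-first order the outdegrees of a finite tree form a Lukasiewicz word, and by Kemperman's
  formula the law of the multiset of outdegrees of \<open>T\<close> on the event of having \<open>n\<close> vertices is, up
  to the factor \<open>1 / n\<close>, that of \<open>n\<close> independent variables with sum \<open>n - 1\<close>. Conditioning on \<open>k\<close>
  leaves and subtracting one from the other outdegrees leaves \<open>m = n - k\<close> independent variables
  conditioned to have sum \<open>s = k - 1\<close>, where \<open>s = o(m)\<close>. Let \<open>w j = \<mu>(j + 1)\<close> and let \<open>A(m, s)\<close> be the
  total weight of the sequences of length \<open>m\<close> and sum \<open>s\<close>. The number \<open>N\<close> of entries equal to \<open>d\<close>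
  satisfies
  \<open>E[binomial(N, r)] = binomial(m, r) w(d)^r A(m - r, s - r d) / A(m, s)\<close>.
  Counting zeros, ones and the total sum of a random sequence gives elementary two-sided bounds on
  \<open>A(m - 1, s) / A(m, s)\<close> and \<open>A(m - 1, s - 1) / A(m, s)\<close>, hence
  \<open>E[binomial(N, r)]\<close> is asymptotic to \<open>(w(d) w(0)^(d - 1) / w(1)^d * s^d / m^(d - 1))^r / r!\<close>.
  The second and third claims are the method of moments, and the first one is a union bound.
\<close>

subsection \<open>Weighted sequences with prescribed sum\<close>

definition comps :: "nat \<Rightarrow> nat \<Rightarrow> nat list set" where
  "comps m s = {xs. length xs = m \<and> sum_list xs = s}"

definition wt :: "(nat \<Rightarrow> 'a::comm_monoid_mult) \<Rightarrow> nat list \<Rightarrow> 'a" where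
  "wt w xs = prod_list (map w xs)"

text \<open>The coefficient of z^s in the \<open>m\<close>-th power of the generating function of
  \<open>w\<close>.\<close>

definition tot :: "(nat \<Rightarrow> real) \<Rightarrow> nat \<Rightarrow> nat \<Rightarrow> real" where
  "tot w m s = (\<Sum>xs\<in>comps m s. wt w xs)"

lemma wt_simps [simp]: "wt w [] = 1" "wt w (x # xs) = w x * wt w xs"
  by (simp_all add: wt_def)

lemma wt_nonneg:
  fixes w :: "nat \<Rightarrow> real"
  shows "(\<And>j. w j \<ge> 0) \<Longrightarrow> wt w xs \<ge> 0"
  by (induction xs) auto

lemma mset_rotate1: "mset (rotate1 xs) = mset xs"
  by (cases xs) auto

lemma wt_cong_mset: "mset xs = mset ys \<Longrightarrow> wt w xs = wt w ys"
  by (metis mset_map prod_mset_prod_list wt_def)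

lemma finite_comps [simp]: "finite (comps m s)"
proof (rule finite_subset)
  show "comps m s \<subseteq> {xs. set xs \<subseteq> {..s} \<and> length xs = m}"
    by (auto simp: comps_def intro: member_le_sum_list)
qed (simp add: finite_lists_length_eq)

lemma comps_0: "comps 0 s = (if s = 0 then {[]} else {})"
  by (auto simp: comps_def)

lemma sum_comps_Suc:
  fixes f :: "nat list \<Rightarrow> 'a::comm_monoid_add"
  shows "(\<Sum>xs\<in>comps (Suc m) s. f xs) = (\<Sum>j\<le>s. \<Sum>xs\<in>comps m (s - j). f (j # xs))"
proof -
  have "(\<Sum>j\<le>s. \<Sum>xs\<in>comps m (s - j). f (j # xs))
      = (\<Sum>(j, xs)\<in>Sigma {..s} (\<lambda>j. comps m (s - j)). f (j # xs))"
    by (simp add: sum.Sigma)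
  also have "\<dots> = (\<Sum>xs\<in>comps (Suc m) s. f xs)"
    by (rule sum.reindex_bij_witness[where i = "\<lambda>xs. (hd xs, tl xs)" and j = "\<lambda>(j, xs). j # xs"])
       (auto simp: comps_def length_Suc_conv)
  finally show ?thesis ..
qed

lemma tot_Suc: "tot w (Suc m) s = (\<Sum>j\<le>s. w j * tot w m (s - j))"
  by (simp add: tot_def sum_comps_Suc sum_distrib_left)

lemma tot_nonneg: "(\<And>j. w j \<ge> 0) \<Longrightarrow> tot w m s \<ge> 0"
  by (simp add: tot_def sum_nonneg wt_nonneg)

text \<open>Exchangeability: rotating by \<open>i\<close> permutes \<open>comps m s\<close>, keeps
  the multiset and hence the weight, and brings entry \<open>i\<close> to the front. The factor
  \<open>g\<close> carries a symmetric statistic along.\<close>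

lemma sum_comps_nth:
  fixes w :: "nat \<Rightarrow> real"
  assumes "i < m"
  shows "(\<Sum>xs\<in>comps m s. wt w xs * g (mset xs) * h (xs ! i))
       = (\<Sum>xs\<in>comps m s. wt w xs * g (mset xs) * h (xs ! 0))"
proof -
  have m: "mset (rotate i xs) = mset xs" for xs :: "nat list"
    by (induction i) (auto simp: mset_rotate1)
  have inj: "inj_on (rotate i) (comps m s)"
    unfolding rotate_def by (rule inj_on_subset[OF inj_fn[OF inj_rotate1]]) simp
  have sub: "rotate i ` comps m s \<subseteq> comps m s"
    using m by (auto simp: comps_def) (metis sum_mset_sum_list)
  have "bij_betw (rotate i) (comps m s) (comps m s)"
    using endo_inj_surj[OF finite_comps sub inj] inj by (simp add: bij_betw_def)
  then have "(\<Sum>xs\<in>comps m s. wt w xs * g (mset xs) * h (xs ! 0))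
      = (\<Sum>xs\<in>comps m s. wt w (rotate i xs) * g (mset (rotate i xs)) * h (rotate i xs ! 0))"
    by (rule sum.reindex_bij_betw[symmetric])
  also have "\<dots> = (\<Sum>xs\<in>comps m s. wt w xs * g (mset xs) * h (xs ! i))"
    by (rule sum.cong) (use assms m in \<open>auto simp: comps_def nth_rotate wt_cong_mset[OF m]\<close>)
  finally show ?thesis ..
qed

lemma sum_comps_sum_nth:
  fixes w :: "nat \<Rightarrow> real"
  shows "(\<Sum>xs\<in>comps m s. wt w xs * g (mset xs) * (\<Sum>i<m. h (xs ! i)))
       = real m * (\<Sum>xs\<in>comps m s. wt w xs * g (mset xs) * h (xs ! 0))"
proof -
  have "(\<Sum>xs\<in>comps m s. wt w xs * g (mset xs) * (\<Sum>i<m. h (xs ! i)))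
      = (\<Sum>i<m. \<Sum>xs\<in>comps m s. wt w xs * g (mset xs) * h (xs ! i))"
    unfolding sum_distrib_left by (rule sum.swap)
  also have "\<dots> = (\<Sum>i<m. \<Sum>xs\<in>comps m s. wt w xs * g (mset xs) * h (xs ! 0))"
    by (intro sum.cong refl sum_comps_nth) simp
  finally show ?thesis by simp
qed

text \<open>By exchangeability all entries have the same weighted mean, and they add up to
  \<open>s\<close>.\<close>

lemma sum_comps_hd:
  fixes w :: "nat \<Rightarrow> real"
  shows "real m * (\<Sum>xs\<in>comps m s. wt w xs * g (mset xs) * real (xs ! 0))
       = real s * (\<Sum>xs\<in>comps m s. wt w xs * g (mset xs))"
proof -
  have "(\<Sum>xs\<in>comps m s. wt w xs * g (mset xs) * (\<Sum>i<m. real (xs ! i)))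
      = (\<Sum>xs\<in>comps m s. wt w xs * g (mset xs) * real s)"
  proof (rule sum.cong)
    fix xs assume "xs \<in> comps m s"
    then have "(\<Sum>i<m. xs ! i) = s"
      by (auto simp: comps_def sum_list_sum_nth lessThan_atLeast0)
    then show "wt w xs * g (mset xs) * (\<Sum>i<m. real (xs ! i)) = wt w xs * g (mset xs) * real s"
      by (metis of_nat_sum)
  qed simp
  then show ?thesis
    unfolding sum_comps_sum_nth[of w g real m s]
    by (simp add: sum_distrib_left mult_ac)
qed

text \<open>Marking \<open>r\<close> of the positions that hold \<open>d\<close> and deleting them
  leaves length \<open>m - r\<close> and sum \<open>s - r * d\<close>. The induction does this entry
  by entry with Pascal's rule. Divided by \<open>tot w m s\<close>, this gives the exact binomial
  moments of the number of entries equal to \<open>d\<close>.\<close>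

lemma sum_choose_count:
  "(\<Sum>xs\<in>comps m s. wt w xs * real (count_list xs d choose r))
   = (if r \<le> m \<and> r * d \<le> s then real (m choose r) * w d ^ r * tot w (m - r) (s - r * d) else 0)"
proof (induction m arbitrary: s r)
  case 0
  then show ?case by (cases r; cases s) (simp_all add: comps_0 tot_def)
next
  case (Suc m)
  define B where "B r m s = (\<Sum>xs\<in>comps m s. wt w xs * real (count_list xs d choose r))" for r m s
  define C where "C r m s = (if r \<le> m \<and> r * d \<le> s
      then real (m choose r) * w d ^ r * tot w (m - r) (s - r * d) else 0)" for r m s
  have IH: "B r m s = C r m s" for r s
    using Suc.IH by (simp add: B_def C_def)
  have step: "(\<Sum>j\<le>s. w j * C r m (s - j))
      = (if r \<le> m \<and> r * d \<le> s then real (m choose r) * w d ^ r * tot w (Suc m - r) (s - r * d) else 0)"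
    for r
  proof (cases "r \<le> m \<and> r * d \<le> s")
    case True
    \<comment> \<open>If the first entry exceeds \<open>s - r * d\<close>, the rest is too small to
      hold \<open>r\<close> copies of \<open>d\<close>, so \<open>C\<close> vanishes there.\<close>
    have "(\<Sum>j\<le>s. w j * C r m (s - j)) = (\<Sum>j\<le>s - r * d. w j * C r m (s - j))"
      by (rule sum.mono_neutral_right) (auto simp: C_def)
    also have "\<dots> = (\<Sum>j\<le>s - r * d. real (m choose r) * w d ^ r * (w j * tot w (m - r) (s - r * d - j)))"
    proof (rule sum.cong)
      fix j assume "j \<in> {..s - r * d}"
      then have "r * d \<le> s - j" "s - j - r * d = s - r * d - j" using True by auto
      then show "w j * C r m (s - j) = real (m choose r) * w d ^ r * (w j * tot w (m - r) (s - r * d - j))"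
        using True by (simp add: C_def)
    qed simp
    also have "\<dots> = real (m choose r) * w d ^ r * tot w (Suc (m - r)) (s - r * d)"
      by (simp only: tot_Suc sum_distrib_left)
    finally show ?thesis using True by (simp add: Suc_diff_le)
  next
    case False
    have "\<not> (r \<le> m \<and> r * d \<le> s - j)" for j using False diff_le_self le_trans by blast
    then show ?thesis using False by (simp only: C_def if_False mult_zero_right sum.neutral_const)
  qed
  show ?case
  proof (cases r)
    case 0
    have "B 0 (Suc m) s = (\<Sum>j\<le>s. w j * B 0 m (s - j))"
      by (simp add: B_def sum_comps_Suc sum_distrib_left mult_ac)
    also have "\<dots> = C 0 (Suc m) s"
      using step[of 0] unfolding IH by (simp add: C_def)
    finally show ?thesis unfolding B_def C_def 0 .
  next
    case (Suc r')
    \<comment> \<open>A first entry \<open>d\<close> raises the count by one; Pascal's rule turns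
      this into an extra term with \<open>r'\<close> in place of \<open>r\<close>.\<close>
    have "B r (Suc m) s = (\<Sum>j\<le>s. w j * B r m (s - j) + (if j = d then w d * B r' m (s - d) else 0))"
      unfolding B_def sum_comps_Suc
      by (intro sum.cong) (auto simp: Suc sum_distrib_left sum.distrib[symmetric] algebra_simps)
    also have "\<dots> = (\<Sum>j\<le>s. w j * C r m (s - j)) + (if d \<le> s then w d * C r' m (s - d) else 0)"
      by (simp add: sum.distrib IH)
    also have "\<dots> = C r (Suc m) s"
    proof -
      \<comment> \<open>For \<open>r' = m\<close> every position is marked, so only the term in
        which the first entry is marked survives.\<close>
      consider "Suc r' > Suc m \<or> Suc r' * d > s" | "r' = m" "Suc r' * d \<le> s" | "r' < m" "Suc r' * d \<le> s"
        by linarith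
      then show ?thesis
      proof cases
        case 1
        then show ?thesis unfolding step by (auto simp: C_def Suc)
      next
        case 2
        then show ?thesis unfolding step by (auto simp: C_def Suc)
      next
        case 3
        then show ?thesis unfolding step
          by (auto simp: C_def Suc algebra_simps)
      qed
    qed
    finally show ?thesis unfolding B_def C_def .
  qed
qed

text \<open>In \<open>luk j xs\<close> the number \<open>j\<close> counts the vertices still to be explored: \<open>xs\<close> is the depth-first
  outdegree sequence of an ordered forest of \<open>j\<close> trees.\<close>

fun luk :: "nat \<Rightarrow> nat list \<Rightarrow> bool" where
  "luk 0 xs \<longleftrightarrow> xs = []"
| "luk (Suc j) [] \<longleftrightarrow> False"
| "luk (Suc j) (x # xs) \<longleftrightarrow> luk (x + j) xs"

lemma luk_sum_list: "luk j xs \<Longrightarrow> sum_list xs + j = length xs"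
  by (induction j xs rule: luk.induct) auto

lemma luk_0_iff_Nil: "luk j [] \<longleftrightarrow> j = 0"
  by (cases j) auto

text \<open>Removing the first tree vertex, of outdegree \<open>x\<close>, changes \<open>j\<close> to \<open>x + j - 1\<close>; by exchangeability the
  average of the first entry over sequences of length \<open>n\<close> and sum \<open>n - j\<close> is \<open>(n - j) / n\<close>.\<close>

lemma kemperman:
  fixes w :: "nat \<Rightarrow> real"
  shows "real n * (\<Sum>xs | luk j xs \<and> length xs = n. wt w xs * g (mset xs))
       = real j * (\<Sum>xs | sum_list xs + j = n \<and> length xs = n. wt w xs * g (mset xs))"
\<comment> \<open>\<open>g\<close> varies because removing a first entry \<open>x\<close> replaces
  it by \<open>\<lambda>M. g (add_mset x M)\<close>.\<close>
proof (induction n arbitrary: j g)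
  case 0
  have "{xs::nat list. sum_list xs + j = 0 \<and> length xs = 0} = (if j = 0 then {[]} else {})"
    by auto
  then show ?case by auto
next
  case (Suc n)
  show ?case
  proof (cases j)
    case 0
    have "{xs. luk 0 xs \<and> length xs = Suc n} = {}" by auto
    then show ?thesis by (simp add: 0)
  next
    case j: (Suc i)
    show ?thesis
    proof (cases "i \<le> n")
      case False
      then have e: "{xs. luk j xs \<and> length xs = Suc n} = {}"
        "{xs. sum_list xs + j = Suc n \<and> length xs = Suc n} = {}"
        using luk_sum_list[of j] j by fastforce+
      show ?thesis unfolding e by simp
    next
      case True
      let ?L = "\<lambda>j n. {xs. luk j xs \<and> length xs = n}"
      have fin: "finite (?L j n)" for j n
        by (rule finite_subset[OF _ finite_comps[of n "n - j"]])
           (auto simp: comps_def dest: luk_sum_list)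
      have C: "{xs. sum_list xs + j = n \<and> length xs = n} = (if j \<le> n then comps n (n - j) else {})"
        for j n :: nat by (auto simp: comps_def)
      \<comment> \<open>Reading \<open>x\<close> leads from \<open>Suc i\<close> pending vertices to
        \<open>x + i\<close>. The range \<open>x \<le> n - i\<close> loses nothing, since each
        pending vertex uses up at least one of the \<open>n\<close> remaining entries.\<close>
      have Q: "(\<Sum>xs\<in>?L j (Suc n). wt w xs * g (mset xs))
          = (\<Sum>x\<le>n - i. w x * (\<Sum>xs\<in>?L (x + i) n. wt w xs * g (add_mset x (mset xs))))"
      proof -
        have "(\<Sum>x\<le>n - i. w x * (\<Sum>xs\<in>?L (x + i) n. wt w xs * g (add_mset x (mset xs))))
            = (\<Sum>(x, xs)\<in>Sigma {..n - i} (\<lambda>x. ?L (x + i) n). wt w (x # xs) * g (mset (x # xs)))"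
          by (subst sum.Sigma[symmetric]) (auto simp: fin sum_distrib_left mult_ac)
        also have "\<dots> = (\<Sum>xs\<in>?L j (Suc n). wt w xs * g (mset xs))"
          by (rule sum.reindex_bij_witness[where i = "\<lambda>xs. (hd xs, tl xs)" and j = "\<lambda>(x, xs). x # xs"])
             (auto simp: length_Suc_conv j dest: luk_sum_list)
        finally show ?thesis ..
      qed
      define S where "S = (\<Sum>xs\<in>comps (Suc n) (n - i). wt w xs * g (mset xs))"
      \<comment> \<open>The factor \<open>n\<close> turns each inner sum into the left-hand side of
        the induction hypothesis.\<close>
      have "real n * (\<Sum>xs\<in>?L j (Suc n). wt w xs * g (mset xs))
          = (\<Sum>x\<le>n - i. w x * (real n * (\<Sum>xs\<in>?L (x + i) n. wt w xs * g (add_mset x (mset xs)))))"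
        unfolding Q by (simp add: sum_distrib_left mult_ac)
      also have "\<dots> = (\<Sum>x\<le>n - i. w x * (real (x + i) *
          (\<Sum>xs\<in>comps n (n - i - x). wt w xs * g (add_mset x (mset xs)))))"
      proof (rule sum.cong)
        fix x assume "x \<in> {..n - i}"
        then have "x + i \<le> n" "n - i - x = n - (x + i)" using True by auto
        then show "w x * (real n * (\<Sum>xs\<in>?L (x + i) n. wt w xs * g (add_mset x (mset xs))))
            = w x * (real (x + i) * (\<Sum>xs\<in>comps n (n - i - x). wt w xs * g (add_mset x (mset xs))))"
          using Suc.IH[where j = "x + i" and g = "\<lambda>M. g (add_mset x M)"] by (simp only: C if_True)
      qed simp
      also have "\<dots> = (\<Sum>xs\<in>comps (Suc n) (n - i). wt w xs * g (mset xs) * (real (xs ! 0) + real i))"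
        unfolding sum_comps_Suc sum_distrib_left
        by (intro sum.cong refl) (simp only: wt_simps mset.simps nth_Cons_0 of_nat_add mult_ac)
      also have "\<dots> = (\<Sum>xs\<in>comps (Suc n) (n - i). wt w xs * g (mset xs) * real (xs ! 0)) + real i * S"
        unfolding S_def distrib_left sum.distrib sum_distrib_left
        by (intro arg_cong2[of _ _ _ _ "(+)"] sum.cong refl) (simp only: mult_ac)
      finally have "real (Suc n) * (real n * (\<Sum>xs\<in>?L j (Suc n). wt w xs * g (mset xs)))
          = real (n - i) * S + real (Suc n) * (real i * S)"
        unfolding S_def by (simp only: distrib_left sum_comps_hd)
      then have eq: "real n * (real (Suc n) * (\<Sum>xs\<in>?L j (Suc n). wt w xs * g (mset xs)))
          = real n * (real j * S)"
        using True by (simp add: j of_nat_diff algebra_simps)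
      have S: "S = (\<Sum>xs | sum_list xs + j = Suc n \<and> length xs = Suc n. wt w xs * g (mset xs))"
        unfolding S_def using True by (intro sum.cong) (auto simp: comps_def j)
      show ?thesis
      \<comment> \<open>The extra factor \<open>n\<close> in \<open>eq\<close> can be cancelled only
        for \<open>n > 0\<close>; for \<open>n = 0\<close> the only word is
        \<open>[0]\<close>.\<close>
      proof (cases "n = 0")
        case True
        have "?L (Suc 0) (Suc 0) = {[0]}"
          "{xs. sum_list xs + Suc 0 = Suc 0 \<and> length xs = Suc 0} = {[0]}"
          by (auto simp: length_Suc_conv luk_0_iff_Nil)
        then show ?thesis using \<open>i \<le> n\<close> True j by simp
      next
        case False
        then show ?thesis using eq by (simp only: S) simp
      qed
    qed
  qed
qed

text \<open>Choose the places of the \<open>k\<close> zeros, then lower the other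
  \<open>n - k\<close> entries by one: their sum falls from \<open>t + n - k\<close> to
  \<open>t\<close>. The induction splits on whether the first entry is zero and combines the two
  parts by Pascal's rule.\<close>

lemma sum_comps_zeros:
  fixes w :: "nat \<Rightarrow> real"
  shows "(\<Sum>xs | length xs = n \<and> count_list xs 0 = k \<and> sum_list xs + k = t + n.
            wt w xs * g (filter_mset (\<lambda>x. 0 < x) (mset xs)))
       = real (n choose k) * w 0 ^ k *
         (\<Sum>ys\<in>comps (n - k) t. wt (\<lambda>j. w (Suc j)) ys * g (image_mset Suc (mset ys)))"
proof (induction n arbitrary: k t g)
  case 0
  have "{xs::nat list. length xs = 0 \<and> count_list xs 0 = k \<and> sum_list xs + k = t + 0}
      = (if k = 0 \<and> t = 0 then {[]} else {})" by auto
  then show ?case by (auto simp: comps_0)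
next
  case (Suc n)
  let ?w = "\<lambda>j. w (Suc j)"
  define L where "L n k t = {xs. length xs = n \<and> count_list xs 0 = k \<and> sum_list xs + k = t + n}"
    for n k t :: nat
  define R where "R m t g = (\<Sum>ys\<in>comps m t. wt ?w ys * g (image_mset Suc (mset ys)))"
    for m t and g :: "nat multiset \<Rightarrow> real"
  have IH: "(\<Sum>xs\<in>L n k t. wt w xs * g (filter_mset (\<lambda>x. 0 < x) (mset xs)))
      = real (n choose k) * w 0 ^ k * R (n - k) t g" for k t and g :: "nat multiset \<Rightarrow> real"
    using Suc.IH by (simp add: L_def R_def)
  have fin: "finite (L n k t)" for n k t
    by (rule finite_subset[OF _ finite_comps[of n "t + n - k"]]) (auto simp: comps_def L_def)
  \<comment> \<open>Nonzero entries are at least one. This yields \<open>y \<le> t\<close> below, so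
    that \<open>t - y\<close> is not truncated.\<close>
  have lower: "n \<le> sum_list xs + k" if "length xs = n" "count_list xs 0 = k" for n k and xs :: "nat list"
    using that by (induction xs arbitrary: n k) (auto split: if_splits, force+)
  define F where "F xs = wt w xs * g (filter_mset (\<lambda>x. 0 < x) (mset xs))" for xs
  have split: "L (Suc n) k t = (#) 0 ` (if k = 0 then {} else L n (k - 1) t)
      \<union> (\<lambda>(y, xs). Suc y # xs) ` Sigma {..t} (\<lambda>y. L n k (t - y))"
    (is "_ = ?A \<union> ?B")
  proof (intro equalityI subsetI)
    fix xs assume "xs \<in> L (Suc n) k t"
    then obtain x ys where xs: "xs = x # ys" "length ys = n" "count_list (x # ys) 0 = k"
        "x + sum_list ys + k = t + Suc n"
      by (auto simp: L_def length_Suc_conv)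
    show "xs \<in> ?A \<union> ?B"
    proof (cases x)
      case 0
      then show ?thesis using xs by (auto simp: L_def)
    next
      case (Suc y)
      then have "y \<le> t" using xs lower[of ys n k] by simp
      then have "xs \<in> ?B" using xs Suc by (intro image_eqI[of _ _ "(y, ys)"]) (auto simp: L_def)
      then show ?thesis ..
    qed
  qed (auto simp: L_def split: if_splits)
  have "(\<Sum>xs\<in>L (Suc n) k t. F xs) = (\<Sum>xs\<in>?A. F xs) + (\<Sum>xs\<in>?B. F xs)"
    unfolding split by (rule sum.union_disjoint) (auto simp: fin)
  also have "(\<Sum>xs\<in>?A. F xs) = (if k = 0 then 0 else
      w 0 * (real (n choose (k - 1)) * w 0 ^ (k - 1) * R (n - (k - 1)) t g))"
  proof (cases "k = 0")
    case False
    then have "(\<Sum>xs\<in>?A. F xs) = (\<Sum>xs\<in>L n (k - 1) t. w 0 * F xs)"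
      by (simp add: sum.reindex F_def mult.assoc)
    also have "\<dots> = w 0 * (real (n choose (k - 1)) * w 0 ^ (k - 1) * R (n - (k - 1)) t g)"
      unfolding sum_distrib_left[symmetric] F_def IH ..
    finally show ?thesis using False by simp
  qed simp
  also have "(\<Sum>xs\<in>?B. F xs) = (\<Sum>(y, xs)\<in>Sigma {..t} (\<lambda>y. L n k (t - y)). F (Suc y # xs))"
    by (subst sum.reindex) (auto simp: inj_on_def intro!: sum.cong)
  also have "\<dots> = (\<Sum>y\<le>t. \<Sum>xs\<in>L n k (t - y). F (Suc y # xs))"
    by (rule sum.Sigma[symmetric]) (auto simp: fin)
  also have "\<dots> = (\<Sum>y\<le>t. w (Suc y) * (real (n choose k) * w 0 ^ k *
      R (n - k) (t - y) (\<lambda>M. g (add_mset (Suc y) M))))"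
  proof (intro sum.cong refl)
    fix y assume "y \<in> {..t}"
    have "(\<Sum>xs\<in>L n k (t - y). F (Suc y # xs)) = (\<Sum>xs\<in>L n k (t - y). w (Suc y) *
        (wt w xs * g (add_mset (Suc y) (filter_mset (\<lambda>x. 0 < x) (mset xs)))))"
      by (simp add: F_def mult.assoc)
    also have "\<dots> = w (Suc y) * (real (n choose k) * w 0 ^ k *
        R (n - k) (t - y) (\<lambda>M. g (add_mset (Suc y) M)))"
      unfolding sum_distrib_left[symmetric] IH[where g = "\<lambda>M. g (add_mset (Suc y) M)"] ..
    finally show "(\<Sum>xs\<in>L n k (t - y). F (Suc y # xs)) = w (Suc y) * (real (n choose k) * w 0 ^ k *
        R (n - k) (t - y) (\<lambda>M. g (add_mset (Suc y) M)))" .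
  qed
  also have "\<dots> = real (n choose k) * w 0 ^ k * R (Suc (n - k)) t g"
    by (simp add: R_def sum_comps_Suc sum_distrib_left mult_ac)
  also have "(if k = 0 then 0 else w 0 * (real (n choose (k - 1)) * w 0 ^ (k - 1) * R (n - (k - 1)) t g))
      + real (n choose k) * w 0 ^ k * R (Suc (n - k)) t g
      = real (Suc n choose k) * w 0 ^ k * R (Suc n - k) t g"
  proof (cases k)
    case k: (Suc k')
    show ?thesis
    proof (cases "k \<le> n")
      case True
      then have "Suc (n - k) = n - k'" "Suc n - k = n - k'" using k by auto
      then show ?thesis using k by (simp add: algebra_simps)
    qed (simp add: k algebra_simps)
  qed simp
  finally show ?case by (simp add: L_def R_def F_def)
qed

subsection \<open>Depth-first exploration\<close>

text \<open>The vertices met, in depth-first order, when starting from the stack \<open>st\<close> and reading the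
  outdegrees from \<open>xs\<close>. As they depend on \<open>xs\<close> only, the event that the exploration reads \<open>xs\<close> is a
  cylinder.\<close>

fun visit :: "nat list list \<Rightarrow> nat list \<Rightarrow> nat list list" where
  "visit (u # st) (x # xs) = u # visit (map (\<lambda>i. u @ [i]) [0..<x] @ st) xs"
| "visit [] xs = []"
| "visit (u # st) [] = []"

lemma length_visit: "luk (length st) xs \<Longrightarrow> length (visit st xs) = length xs"
  by (induction st xs rule: visit.induct) auto

text \<open>Pairwise incomparable words root disjoint subtrees, so no word can be met twice.
  Repetitions on the stack are excluded too, as a word is a prefix of itself.\<close>

definition antichain :: "'a list list \<Rightarrow> bool" where
  "antichain st \<longleftrightarrow> sorted_wrt (\<lambda>u v. \<not> prefix u v \<and> \<not> prefix v u) st"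

text \<open>A word comparable with a child of \<open>u\<close> is comparable with \<open>u\<close>,
  and distinct children of \<open>u\<close> are incomparable.\<close>

lemma antichain_children:
  assumes "antichain (u # st)"
  shows "antichain (map (\<lambda>i. u @ [i]) [0..<x] @ st)"
proof -
  have 1: "\<not> prefix (u @ [i]) v \<and> \<not> prefix v (u @ [i])" if "v \<in> set st" for i v
    using that assms append_prefixD[of u "[i]" v] unfolding antichain_def by auto
  have "sorted_wrt (\<lambda>i j. i \<noteq> j \<and> j \<noteq> i) [0..<x]"
    using sorted_wrt_upt[of 0 x] by (rule sorted_wrt_mono_rel[rotated]) auto
  then show ?thesis
    using assms 1 by (auto simp: antichain_def sorted_wrt_append sorted_wrt_map)
qed

lemma not_prefix_children:
  assumes "antichain (u # st)" "v \<in> set (map (\<lambda>i. u @ [i]) [0..<x] @ st)"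
  shows "\<not> prefix v u"
  using assms by (auto simp: antichain_def)

lemma visit_prefix: "v \<in> set (visit st xs) \<Longrightarrow> \<exists>u\<in>set st. prefix u v"
proof (induction st xs rule: visit.induct)
  case (1 u st x xs)
  have "\<exists>z\<in>set (u # st). prefix z v" if "y \<in> set (map (\<lambda>i. u @ [i]) [0..<x] @ st)" "prefix y v" for y
    using that append_prefixD[of u] by auto
  then show ?case using 1 by auto
qed auto

text \<open>Every word visited after \<open>u\<close> extends a word of the new stack, and no word
  of that stack is a prefix of \<open>u\<close>.\<close>

lemma distinct_visit: "antichain st \<Longrightarrow> distinct (visit st xs)"
proof (induction st xs rule: visit.induct)
  case (1 u st x xs)
  let ?st = "map (\<lambda>i. u @ [i]) [0..<x] @ st"
  have "u \<notin> set (visit ?st xs)"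
    using not_prefix_children[of u st _ x] visit_prefix[of u ?st xs] 1(2) by blast
  then show ?case using 1 antichain_children[of u st x] by simp
qed auto

section \<open>Subtrees and the correctness of the exploration\<close>

definition subtree :: "(nat list \<Rightarrow> nat) \<Rightarrow> nat list \<Rightarrow> nat list set" where
  "subtree \<omega> u = (@) u ` bgw_tree (\<lambda>v. \<omega> (u @ v))"

lemma Cons_in_bgw_tree_iff:
  "i # v \<in> bgw_tree \<omega> \<longleftrightarrow> i < \<omega> [] \<and> v \<in> bgw_tree (\<lambda>z. \<omega> (i # z))"
proof
  assume *: "i # v \<in> bgw_tree \<omega>"
  then have "j < \<omega> (i # v')" if "v = v' @ j # w" for v' j w
    using that unfolding bgw_tree_def by (metis (mono_tags, lifting) append_Cons mem_Collect_eq)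
  then show "i < \<omega> [] \<and> v \<in> bgw_tree (\<lambda>z. \<omega> (i # z))"
    using * unfolding bgw_tree_def by blast
next
  assume *: "i < \<omega> [] \<and> v \<in> bgw_tree (\<lambda>z. \<omega> (i # z))"
  have "j < \<omega> a" if "i # v = a @ j # w" for a j w
    using that * by (cases a) (auto simp: bgw_tree_def)
  then show "i # v \<in> bgw_tree \<omega>" unfolding bgw_tree_def by blast
qed

lemma Nil_in_bgw_tree [simp]: "[] \<in> bgw_tree \<omega>"
  by (simp add: bgw_tree_def)

lemma subtree_unfold: "subtree \<omega> u = insert u (\<Union>i<\<omega> u. subtree \<omega> (u @ [i]))"
proof (intro equalityI subsetI)
  fix z assume "z \<in> subtree \<omega> u"
  then obtain v where v: "z = u @ v" "v \<in> bgw_tree (\<lambda>v. \<omega> (u @ v))" by (auto simp: subtree_def)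
  then show "z \<in> insert u (\<Union>i<\<omega> u. subtree \<omega> (u @ [i]))"
    by (cases v) (auto simp: Cons_in_bgw_tree_iff subtree_def)
next
  fix z assume "z \<in> insert u (\<Union>i<\<omega> u. subtree \<omega> (u @ [i]))"
  then consider "z = u" | i v where "i < \<omega> u" "z = u @ i # v" "v \<in> bgw_tree (\<lambda>v. \<omega> (u @ i # v))"
    by (auto simp: subtree_def)
  then show "z \<in> subtree \<omega> u"
    by cases (auto simp: subtree_def Cons_in_bgw_tree_iff intro!: image_eqI[of _ _ "[]"])
qed

lemma subtree_prefix: "v \<in> subtree \<omega> u \<Longrightarrow> prefix u v"
  by (auto simp: subtree_def)

lemma subtree_Nil: "subtree \<omega> [] = bgw_tree \<omega>"
  by (simp add: subtree_def)

lemma subtrees_children: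
  "(\<Union>v\<in>set (u # st). subtree \<omega> v)
   = insert u (\<Union>v\<in>set (map (\<lambda>i. u @ [i]) [0..<\<omega> u] @ st). subtree \<omega> v)"
  using subtree_unfold[of \<omega> u] by (auto simp: atLeast0LessThan)

text \<open>The equation \<open>map \<omega> (visit st xs) = xs\<close> says that the word read is
  the one prescribed by \<open>\<omega>\<close>. Each step is then an instance of
  \<open>subtrees_children\<close>, and \<open>luk\<close> makes word and stack run out
  together.\<close>

lemma set_visit:
  "luk (length st) xs \<Longrightarrow> map \<omega> (visit st xs) = xs \<Longrightarrow> set (visit st xs) = (\<Union>u\<in>set st. subtree \<omega> u)"
proof (induction st xs rule: visit.induct)
  case (1 u st x xs)
  then have x: "x = \<omega> u" by simp
  show ?case using 1 unfolding subtrees_children x by simp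
qed (auto simp: luk_0_iff_Nil)

text \<open>Induction on the number of vertices still to be visited. It drops at each step because,
  by the antichain property, the top of the stack lies in none of the subtrees rooted at the new
  stack.\<close>

lemma visit_exists:
  assumes "finite (\<Union>u\<in>set st. subtree \<omega> u)" "antichain st"
  shows "\<exists>xs. luk (length st) xs \<and> map \<omega> (visit st xs) = xs"
  using assms
proof (induction "card (\<Union>u\<in>set st. subtree \<omega> u)" arbitrary: st rule: less_induct)
  case less
  show ?case
  proof (cases st)
    case Nil
    then show ?thesis by (intro exI[of _ "[]"]) simp
  next
    case (Cons u st')
    let ?st = "map (\<lambda>i. u @ [i]) [0..<\<omega> u] @ st'"
    have eq: "(\<Union>v\<in>set st. subtree \<omega> v) = insert u (\<Union>v\<in>set ?st. subtree \<omega> v)"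
      unfolding Cons by (rule subtrees_children)
    have "u \<notin> (\<Union>v\<in>set ?st. subtree \<omega> v)"
      using not_prefix_children[of u st' _ "\<omega> u"] subtree_prefix[of u \<omega>] less.prems Cons by blast
    then have "card (\<Union>v\<in>set ?st. subtree \<omega> v) < card (\<Union>v\<in>set st. subtree \<omega> v)"
      using less.prems(1) unfolding eq by simp
    moreover have "finite (\<Union>v\<in>set ?st. subtree \<omega> v)" "antichain ?st"
      using less.prems antichain_children unfolding eq by (auto simp: Cons)
    ultimately obtain xs where "luk (length ?st) xs" "map \<omega> (visit ?st xs) = xs"
      using less.hyps by blast
    then show ?thesis by (intro exI[of _ "\<omega> u # xs"]) (simp add: Cons)
  qed
qed

text \<open>Both words face the same top of stack \<open>u\<close>, so both continue with
  \<open>\<omega> u\<close>. Hence distinct Lukasiewicz words have disjoint cylinders.\<close>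

lemma visit_unique:
  "luk (length st) xs \<Longrightarrow> map \<omega> (visit st xs) = xs \<Longrightarrow>
   luk (length st) ys \<Longrightarrow> map \<omega> (visit st ys) = ys \<Longrightarrow> xs = ys"
proof (induction st xs arbitrary: ys rule: visit.induct)
  case (1 u st x xs)
  from 1(4) obtain y ys' where ys: "ys = y # ys'" by (cases ys) auto
  have y: "y = \<omega> u" and x: "x = \<omega> u" using 1(3,5) unfolding ys by simp_all
  have "xs = ys'"
    by (rule 1(1)) (use 1(2-5) in \<open>simp_all add: ys x y\<close>)
  then show ?case by (simp add: ys x y)
qed (auto simp: luk_0_iff_Nil)

text \<open>Meaningful for finite trees only, as \<open>mset_set\<close> of an infinite set is
  empty.\<close>

definition degs :: "utree \<Rightarrow> nat multiset" where
  "degs t = image_mset (outdeg t) (mset_set t)"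

lemma num_outdeg_eq_count: "finite t \<Longrightarrow> num_outdeg i t = count (degs t) i"
  by (auto simp: num_outdeg_def degs_def count_image_mset intro!: arg_cong[of _ _ card])

lemma deg_max_eq_Max: "finite t \<Longrightarrow> deg_max t = Max (set_mset (degs t))"
  by (simp add: deg_max_def degs_def)

lemma bgw_tree_of_visit:
  assumes "luk 1 xs" "map \<omega> (visit [[]] xs) = xs"
  shows "finite (bgw_tree \<omega>)" "card (bgw_tree \<omega>) = length xs" "degs (bgw_tree \<omega>) = mset xs"
proof -
  have t: "bgw_tree \<omega> = set (visit [[]] xs)"
    using set_visit[of "[[]]" xs \<omega>] assms by (simp add: subtree_Nil)
  have d: "distinct (visit [[]] xs)"
    by (rule distinct_visit) (simp add: antichain_def)
  show "finite (bgw_tree \<omega>)" by (simp add: t)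
  show "card (bgw_tree \<omega>) = length xs"
    using length_visit[of "[[]]" xs] assms d by (simp add: t distinct_card)
  have "degs (bgw_tree \<omega>) = image_mset \<omega> (mset_set (bgw_tree \<omega>))"
    unfolding degs_def by (intro image_mset_cong) (simp add: t outdeg_bgw_tree[of _ \<omega>, unfolded t])
  also have "\<dots> = mset (map \<omega> (visit [[]] xs))"
    by (simp add: t d mset_set_set)
  finally show "degs (bgw_tree \<omega>) = mset xs" by (simp add: assms)
qed

lemma visit_of_bgw_tree:
  assumes "finite (bgw_tree \<omega>)"
  obtains xs where "luk 1 xs" "map \<omega> (visit [[]] xs) = xs"
proof -
  have "finite (\<Union>u\<in>set [[]]. subtree \<omega> u)" "antichain [[]]"
    using assms by (simp_all add: subtree_Nil antichain_def)
  from visit_exists[OF this] show ?thesis using that by fastforce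
qed

section \<open>Cylinder probabilities and integrals over trees of given size\<close>

lemma emeasure_bgw_space_coords:
  assumes "distinct us" "length us = length xs"
  shows "emeasure (bgw_space \<mu>) {\<omega> \<in> space (bgw_space \<mu>). map \<omega> us = xs} = ennreal (wt (pmf \<mu>) xs)"
proof -
  interpret product_prob_space "\<lambda>_::nat list. measure_pmf \<mu>" UNIV
    by unfold_locales
  \<comment> \<open>Any function with the prescribed values on \<open>us\<close> serves; its values
    elsewhere do not matter.\<close>
  define \<omega>0 where "\<omega>0 = the \<circ> map_of (zip us xs)"
  have \<omega>0: "map \<omega>0 us = xs"
    unfolding \<omega>0_def by (rule nth_equalityI) (use assms map_of_zip_nth in \<open>auto simp: map_of_zip_nth\<close>)
  have "{\<omega> \<in> space (bgw_space \<mu>). map \<omega> us = xs} = {\<omega> \<in> space (bgw_space \<mu>). \<forall>u\<in>set us. \<omega> u \<in> {\<omega>0 u}}"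
    by (auto simp flip: \<omega>0)
  also have "emeasure (bgw_space \<mu>) \<dots> = (\<Prod>u\<in>set us. emeasure (measure_pmf \<mu>) {\<omega>0 u})"
    unfolding bgw_space_def by (rule emeasure_PiM_Collect) auto
  also have "\<dots> = ennreal (\<Prod>u\<in>set us. pmf \<mu> (\<omega>0 u))"
    by (simp add: emeasure_pmf_single prod_ennreal)
  also have "(\<Prod>u\<in>set us. pmf \<mu> (\<omega>0 u)) = wt (pmf \<mu>) (map \<omega>0 us)"
    using assms(1) by (simp add: wt_def prod.distinct_set_conv_list comp_def)
  finally show ?thesis by (simp add: \<omega>0)
qed

lemma finite_luk: "finite {xs. luk j xs \<and> length xs = n}"
  by (rule finite_subset[OF _ finite_comps[of n "n - j"]]) (auto simp: comps_def dest: luk_sum_list)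

text \<open>The event of having \<open>n\<close> vertices is the disjoint union of the cylinders of
  the finitely many Lukasiewicz words of length \<open>n\<close>, and on each of them the multiset
  of outdegrees is constant.\<close>

lemma nn_integral_bgw_space:
  "(\<integral>\<^sup>+\<omega>. (if finite (bgw_tree \<omega>) \<and> card (bgw_tree \<omega>) = n then g (degs (bgw_tree \<omega>)) else 0) \<partial>bgw_space \<mu>)
   = (\<Sum>xs | luk 1 xs \<and> length xs = n. ennreal (wt (pmf \<mu>) xs) * g (mset xs))"
proof -
  let ?L = "{xs. luk 1 xs \<and> length xs = n}"
  define E where "E xs = {\<omega> \<in> space (bgw_space \<mu>). map \<omega> (visit [[]] xs) = xs}" for xs
  have E: "emeasure (bgw_space \<mu>) (E xs) = ennreal (wt (pmf \<mu>) xs)" if "xs \<in> ?L" for xs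
    unfolding E_def using that
    by (intro emeasure_bgw_space_coords distinct_visit length_visit) (auto simp: antichain_def)
  have [measurable]: "E xs \<in> sets (bgw_space \<mu>)" for xs
  proof -
    have "E xs = {\<omega> \<in> space (bgw_space \<mu>). length (visit [[]] xs) = length xs \<and>
        (\<forall>i<length xs. \<omega> (visit [[]] xs ! i) = xs ! i)}"
      unfolding E_def by (auto simp: list_eq_iff_nth_eq)
    also have "\<dots> \<in> sets (bgw_space \<mu>)" by measurable
    finally show ?thesis .
  qed
  have "(\<integral>\<^sup>+\<omega>. (if finite (bgw_tree \<omega>) \<and> card (bgw_tree \<omega>) = n then g (degs (bgw_tree \<omega>)) else 0) \<partial>bgw_space \<mu>)
      = (\<integral>\<^sup>+\<omega>. (\<Sum>xs\<in>?L. g (mset xs) * indicator (E xs) \<omega>) \<partial>bgw_space \<mu>)"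
  proof (rule nn_integral_cong)
    fix \<omega> assume \<omega>: "\<omega> \<in> space (bgw_space \<mu>)"
    show "(if finite (bgw_tree \<omega>) \<and> card (bgw_tree \<omega>) = n then g (degs (bgw_tree \<omega>)) else 0)
        = (\<Sum>xs\<in>?L. g (mset xs) * indicator (E xs) \<omega>)"
    proof (cases "finite (bgw_tree \<omega>) \<and> card (bgw_tree \<omega>) = n")
      case True
      then have "finite (bgw_tree \<omega>)" by simp
      then obtain xs where xs: "luk 1 xs" "map \<omega> (visit [[]] xs) = xs"
        by (rule visit_of_bgw_tree)
      have in_E: "\<omega> \<in> E xs" unfolding E_def using \<omega> xs(2) by blast
      \<comment> \<open>Disjointness of the cylinders: only the word that \<open>\<omega>\<close>
        itself produces contributes to the sum.\<close>
      have eq_xs: "ys = xs" if "ys \<in> ?L" "\<omega> \<in> E ys" for ys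
      proof (rule visit_unique[of "[[]]" _ \<omega>])
        show "luk (length [[]]) ys" "luk (length [[]]) xs" using that(1) xs(1) by simp_all
        show "map \<omega> (visit [[]] ys) = ys" using that(2) unfolding E_def by blast
      qed (fact xs(2))
      have "indicator (E ys) \<omega> = (if ys = xs then 1 else 0 :: ennreal)" if "ys \<in> ?L" for ys
      proof (cases "ys = xs")
        case False
        then have "\<omega> \<notin> E ys" using eq_xs that by blast
        then show ?thesis using False by simp
      qed (simp add: in_E)
      then have "(\<Sum>ys\<in>?L. g (mset ys) * indicator (E ys) \<omega>) = (\<Sum>ys\<in>?L. if ys = xs then g (mset xs) else 0)"
        by (intro sum.cong) auto
      also have "\<dots> = g (mset xs)"
        using bgw_tree_of_visit[OF xs] True xs(1) by (simp add: finite_luk)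
      finally show ?thesis using True bgw_tree_of_visit[OF xs] by simp
    next
      case False
      have "\<omega> \<notin> E ys" if "ys \<in> ?L" for ys
        using bgw_tree_of_visit(1,2)[of ys \<omega>] that False unfolding E_def by blast
      then have "indicator (E ys) \<omega> = (0 :: ennreal)" if "ys \<in> ?L" for ys
        using that by (simp add: indicator_def)
      then show ?thesis unfolding if_not_P[OF False] by simp
    qed
  qed
  also have "\<dots> = (\<Sum>xs\<in>?L. g (mset xs) * emeasure (bgw_space \<mu>) (E xs))"
    by (subst nn_integral_sum) (auto simp: nn_integral_cmult_indicator)
  finally show ?thesis by (simp add: E mult.commute)
qed

subsection \<open>The law of the conditioned tree\<close>

text \<open>Conditioning on the number of leaves fixes the multiplicity of 0, so only the positive
  outdegrees remain random; they are the ones lowered by one.\<close>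

abbreviation pos :: "nat multiset \<Rightarrow> nat multiset" where
  "pos M \<equiv> filter_mset (\<lambda>x. 0 < x) M"

text \<open>The expectation of \<open>g\<close> over \<open>m\<close> independent entries with
  weights \<open>w\<close>, conditioned on having sum \<open>s\<close>.\<close>

definition avg :: "(nat \<Rightarrow> real) \<Rightarrow> nat \<Rightarrow> nat \<Rightarrow> (nat list \<Rightarrow> real) \<Rightarrow> real" where
  "avg w m s g = (\<Sum>ys\<in>comps m s. wt w ys * g ys) / tot w m s"

text \<open>Kemperman's formula for a single tree, \<open>j = 1\<close>, gives the factor
  \<open>1 / n\<close> and sequences of sum \<open>n - 1\<close>. Extracting \<open>k\<close> zeros
  and lowering the rest by one leaves length \<open>n - k\<close> and sum
  \<open>(n - 1) - (n - k) = k - 1\<close>.\<close>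

lemma nn_integral_bgw_event:
  assumes "0 < k" "k \<le> n" and h: "\<And>M. h M \<ge> 0"
  shows "(\<integral>\<^sup>+\<omega>. ennreal (h (pos (degs (bgw_tree \<omega>)))) * indicator (bgw_event \<mu> n k) \<omega> \<partial>bgw_space \<mu>)
    = ennreal (real (n choose k) * pmf \<mu> 0 ^ k / real n *
        (\<Sum>ys\<in>comps (n - k) (k - 1). wt (\<lambda>j. pmf \<mu> (Suc j)) ys * h (image_mset Suc (mset ys))))"
proof -
  define g :: "nat multiset \<Rightarrow> real" where "g M = (if count M 0 = k then h (pos M) else 0)" for M
  have "(\<integral>\<^sup>+\<omega>. ennreal (h (pos (degs (bgw_tree \<omega>)))) * indicator (bgw_event \<mu> n k) \<omega> \<partial>bgw_space \<mu>)
    = (\<integral>\<^sup>+\<omega>. (if finite (bgw_tree \<omega>) \<and> card (bgw_tree \<omega>) = n then ennreal (g (degs (bgw_tree \<omega>))) else 0) \<partial>bgw_space \<mu>)"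
    by (intro nn_integral_cong) (auto simp: bgw_event_def indicator_def g_def num_outdeg_eq_count)
  also have "\<dots> = (\<Sum>xs | luk 1 xs \<and> length xs = n. ennreal (wt (pmf \<mu>) xs) * ennreal (g (mset xs)))"
    by (rule nn_integral_bgw_space)
  also have "\<dots> = ennreal (\<Sum>xs | luk 1 xs \<and> length xs = n. wt (pmf \<mu>) xs * g (mset xs))"
    by (subst sum_ennreal[symmetric]) (auto simp: g_def h wt_nonneg ennreal_mult intro!: sum.cong)
  also have "(\<Sum>xs | luk 1 xs \<and> length xs = n. wt (pmf \<mu>) xs * g (mset xs))
      = (\<Sum>xs | sum_list xs + 1 = n \<and> length xs = n. wt (pmf \<mu>) xs * g (mset xs)) / real n"
    using kemperman[where n = n and j = 1 and w = "pmf \<mu>" and g = g] assms by (simp add: field_simps)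
  also have "(\<Sum>xs | sum_list xs + 1 = n \<and> length xs = n. wt (pmf \<mu>) xs * g (mset xs))
      = (\<Sum>xs | length xs = n \<and> count_list xs 0 = k \<and> sum_list xs + k = (k - 1) + n.
          wt (pmf \<mu>) xs * h (pos (mset xs)))"
  proof (rule sum.mono_neutral_cong_right)
    show "finite {xs. sum_list xs + 1 = n \<and> length xs = n}"
      by (rule finite_subset[OF _ finite_comps[of n "n - 1"]]) (auto simp: comps_def)
  qed (use assms in \<open>auto simp: g_def count_mset\<close>)
  also have "\<dots> = real (n choose k) * pmf \<mu> 0 ^ k *
      (\<Sum>ys\<in>comps (n - k) (k - 1). wt (\<lambda>j. pmf \<mu> (Suc j)) ys * h (image_mset Suc (mset ys)))"
    by (rule sum_comps_zeros)
  finally show ?thesis by (simp add: field_simps)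
qed

text \<open>The prefactor of \<open>nn_integral_bgw_event\<close> also occurs in the probability of
  the conditioning event and cancels. Agreement of \<open>f\<close> with the statistic is asked on
  finite trees, the only ones in the event.\<close>

lemma nn_integral_bgw_cond:
  assumes "0 < k" "k \<le> n" "pmf \<mu> 0 > 0" and h: "\<And>M. h M \<ge> 0"
    and tot: "tot (\<lambda>j. pmf \<mu> (Suc j)) (n - k) (k - 1) > 0"
    and [measurable]: "f \<in> borel_measurable (bgw_space \<mu>)"
    and f: "\<And>\<omega>. finite (bgw_tree \<omega>) \<Longrightarrow> f \<omega> = ennreal (h (pos (degs (bgw_tree \<omega>))))"
  shows "(\<integral>\<^sup>+\<omega>. f \<omega> \<partial>bgw_cond \<mu> n k)
    = ennreal (avg (\<lambda>j. pmf \<mu> (Suc j)) (n - k) (k - 1) (\<lambda>ys. h (image_mset Suc (mset ys))))"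
proof -
  let ?w = "\<lambda>j. pmf \<mu> (Suc j)"
  define c where "c = real (n choose k) * pmf \<mu> 0 ^ k / real n"
  have c: "c > 0" using assms by (simp add: c_def)
  have "emeasure (bgw_space \<mu>) (bgw_event \<mu> n k)
      = (\<integral>\<^sup>+\<omega>. ennreal ((\<lambda>_. 1) (pos (degs (bgw_tree \<omega>)))) * indicator (bgw_event \<mu> n k) \<omega> \<partial>bgw_space \<mu>)"
    by simp
  also have "\<dots> = ennreal (c * tot ?w (n - k) (k - 1))"
    unfolding c_def tot_def by (subst nn_integral_bgw_event) (use assms in auto)
  finally have e: "emeasure (bgw_space \<mu>) (bgw_event \<mu> n k) = ennreal (c * tot ?w (n - k) (k - 1))" .
  have "(\<integral>\<^sup>+\<omega>. f \<omega> * indicator (bgw_event \<mu> n k) \<omega> \<partial>bgw_space \<mu>)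
      = (\<integral>\<^sup>+\<omega>. ennreal (h (pos (degs (bgw_tree \<omega>)))) * indicator (bgw_event \<mu> n k) \<omega> \<partial>bgw_space \<mu>)"
    by (intro nn_integral_cong) (auto simp: indicator_def bgw_event_def f)
  also have "\<dots> = ennreal (c * (\<Sum>ys\<in>comps (n - k) (k - 1). wt ?w ys * h (image_mset Suc (mset ys))))"
    unfolding c_def by (rule nn_integral_bgw_event) (use assms in auto)
  finally show ?thesis
    unfolding bgw_cond_def avg_def
    by (subst nn_integral_uniform_measure)
       (use c tot h in \<open>auto simp: e divide_ennreal sum_nonneg wt_nonneg\<close>)
qed

lemma sets_bgw_cond [measurable_cong]: "sets (bgw_cond \<mu> n k) = sets (bgw_space \<mu>)"
  by (simp add: bgw_cond_def)

lemma measure_bgw_cond: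
  assumes "0 < k" "k \<le> n" "pmf \<mu> 0 > 0"
    and tot: "tot (\<lambda>j. pmf \<mu> (Suc j)) (n - k) (k - 1) > 0"
    and [measurable]: "Measurable.pred (bgw_space \<mu>) P"
    and P: "\<And>\<omega>. finite (bgw_tree \<omega>) \<Longrightarrow> P \<omega> \<longleftrightarrow> Q (pos (degs (bgw_tree \<omega>)))"
  shows "\<P>(\<omega> in bgw_cond \<mu> n k. P \<omega>)
    = avg (\<lambda>j. pmf \<mu> (Suc j)) (n - k) (k - 1) (\<lambda>ys. of_bool (Q (image_mset Suc (mset ys))))"
proof -
  have "emeasure (bgw_cond \<mu> n k) {\<omega> \<in> space (bgw_cond \<mu> n k). P \<omega>}
      = (\<integral>\<^sup>+\<omega>. indicator {\<omega> \<in> space (bgw_cond \<mu> n k). P \<omega>} \<omega> \<partial>bgw_cond \<mu> n k)"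
    by (rule nn_integral_indicator[symmetric]) measurable
  also have "\<dots> = (\<integral>\<^sup>+\<omega>. of_bool (P \<omega>) \<partial>bgw_cond \<mu> n k)"
    by (intro nn_integral_cong) (auto simp: indicator_def)
  also have "\<dots> = ennreal (avg (\<lambda>j. pmf \<mu> (Suc j)) (n - k) (k - 1)
      (\<lambda>ys. of_bool (Q (image_mset Suc (mset ys)))))"
    by (rule nn_integral_bgw_cond) (use assms in \<open>auto simp: of_bool_def\<close>)
  finally show ?thesis
    using tot by (simp add: measure_def avg_def sum_nonneg wt_nonneg)
qed

text \<open>An outdegree at most \<open>d\<close> becomes an entry below \<open>d\<close>. Outdegree
  zero never violates the bound, so passing to \<open>pos\<close> is harmless.\<close>

lemma prob_deg_max_bgw_cond:
  assumes "0 < k" "k \<le> n" "pmf \<mu> 0 > 0" "tot (\<lambda>j. pmf \<mu> (Suc j)) (n - k) (k - 1) > 0"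
  shows "\<P>(\<omega> in bgw_cond \<mu> n k. deg_max (bgw_tree \<omega>) \<le> d)
    = avg (\<lambda>j. pmf \<mu> (Suc j)) (n - k) (k - 1) (\<lambda>ys. of_bool (\<forall>y\<in>set ys. y < d))"
proof -
  have *: "deg_max (bgw_tree \<omega>) \<le> d \<longleftrightarrow> (\<forall>x\<in>#pos (degs (bgw_tree \<omega>)). x \<le> d)" if "finite (bgw_tree \<omega>)" for \<omega>
  proof -
    \<comment> \<open>The root provides an element, so that \<open>Max\<close> is taken over a
      nonempty set.\<close>
    have "set_mset (degs (bgw_tree \<omega>)) \<noteq> {}"
      using that Nil_in_bgw_tree[of \<omega>] by (auto simp: degs_def simp del: Nil_in_bgw_tree)
    then have "deg_max (bgw_tree \<omega>) \<le> d \<longleftrightarrow> (\<forall>x\<in>#degs (bgw_tree \<omega>). x \<le> d)"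
      by (simp add: deg_max_eq_Max[OF that])
    also have "\<dots> \<longleftrightarrow> (\<forall>x\<in>#pos (degs (bgw_tree \<omega>)). x \<le> d)" by auto
    finally show ?thesis .
  qed
  show ?thesis
    by (subst measure_bgw_cond[where Q = "\<lambda>M. \<forall>x\<in>#M. x \<le> d"])
       (use assms * in \<open>auto simp: Suc_le_eq\<close>)
qed

lemma count_image_Suc: "count (image_mset Suc M) (Suc d) = count M d"
  by (induction M) auto

lemma num_outdeg_bgw_tree:
  "finite (bgw_tree \<omega>) \<Longrightarrow> num_outdeg (Suc d) (bgw_tree \<omega>) = count (pos (degs (bgw_tree \<omega>))) (Suc d)"
  by (simp add: num_outdeg_eq_count)

lemma prob_num_outdeg_bgw_cond:
  assumes "0 < k" "k \<le> n" "pmf \<mu> 0 > 0" "tot (\<lambda>j. pmf \<mu> (Suc j)) (n - k) (k - 1) > 0"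
  shows "\<P>(\<omega> in bgw_cond \<mu> n k. A (num_outdeg (Suc d) (bgw_tree \<omega>)))
    = avg (\<lambda>j. pmf \<mu> (Suc j)) (n - k) (k - 1) (\<lambda>ys. of_bool (A (count_list ys d)))"
  by (subst measure_bgw_cond[where Q = "\<lambda>M. A (count M (Suc d))"])
     (use assms in \<open>auto simp: num_outdeg_bgw_tree count_image_Suc count_mset\<close>)

lemma nn_integral_num_outdeg_bgw_cond:
  fixes h :: "nat \<Rightarrow> real"
  assumes "0 < k" "k \<le> n" "pmf \<mu> 0 > 0" "tot (\<lambda>j. pmf \<mu> (Suc j)) (n - k) (k - 1) > 0"
    and "\<And>j. h j \<ge> 0"
  shows "(\<integral>\<^sup>+\<omega>. ennreal (h (num_outdeg (Suc d) (bgw_tree \<omega>))) \<partial>bgw_cond \<mu> n k)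
    = ennreal (avg (\<lambda>j. pmf \<mu> (Suc j)) (n - k) (k - 1) (\<lambda>ys. h (count_list ys d)))"
  by (subst nn_integral_bgw_cond[where h = "\<lambda>M. h (count M (Suc d))"])
     (use assms in \<open>auto simp: num_outdeg_bgw_tree count_image_Suc count_mset\<close>)

subsection \<open>Asymptotics of the total weight\<close>

lemma sum_power_le:
  fixes x :: real
  assumes "0 \<le> x" "x \<le> 1 / 2"
  shows "(\<Sum>j=a..s. x ^ j) \<le> 2 * x ^ a"
proof (cases "a \<le> s")
  case True
  have "(1 / 2) * (\<Sum>j=a..s. x ^ j) \<le> (1 - x) * (\<Sum>j=a..s. x ^ j)"
    using assms by (intro mult_right_mono sum_nonneg) auto
  also have "\<dots> = x ^ a - x ^ Suc s" by (rule sum_gp_multiplied[OF True])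
  also have "\<dots> \<le> x ^ a" using assms by simp
  finally show ?thesis by simp
qed (use assms in simp)

lemma length_le_zeros_plus_sum: "length xs \<le> count_list xs 0 + sum_list (xs :: nat list)"
  by (induction xs) auto

lemma count_list_one_le_sum: "count_list xs (Suc 0) \<le> sum_list xs"
  by (induction xs) auto

text \<open>Instantiated with \<open>w j = \<mu>(j + 1)\<close>, so that \<open>w 0\<close> and
  \<open>w 1\<close> are \<open>\<mu>(1)\<close> and \<open>\<mu>(2)\<close>.\<close>

locale weights =
  fixes w :: "nat \<Rightarrow> real"
  assumes w_nonneg: "w j \<ge> 0" and w_le_1: "w j \<le> 1" and w0: "w 0 > 0" and w1: "w 1 > 0"
begin

lemma tot_Suc_ge:
  assumes "j \<le> s" shows "w j * tot w m (s - j) \<le> tot w (Suc m) s"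
  unfolding tot_Suc
  by (rule member_le_sum[where f = "\<lambda>j. w j * tot w m (s - j)"]) (use assms in \<open>auto simp: w_nonneg tot_nonneg\<close>)

text \<open>The sequences made of \<open>s\<close> ones and \<open>m - s\<close> zeros already have
  positive weight.\<close>

lemma tot_pos: "s \<le> m \<Longrightarrow> tot w m s > 0"
proof (induction m arbitrary: s)
  case (Suc m)
  consider "s \<le> m" | "s = Suc m" using Suc.prems by linarith
  then show ?case
  proof cases
    case 1
    have "0 < w 0 * tot w m (s - 0)" using Suc.IH[OF 1] w0 by simp
    also have "\<dots> \<le> tot w (Suc m) s" by (rule tot_Suc_ge) simp
    finally show ?thesis .
  next
    case 2
    have "0 < w 1 * tot w m (s - 1)" using Suc.IH[of m] w1 2 by simp
    also have "\<dots> \<le> tot w (Suc m) s" by (rule tot_Suc_ge) (simp add: 2)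
    finally show ?thesis .
  qed
qed (simp add: tot_def comps_0)

lemma sum_count:
  "(\<Sum>xs\<in>comps (Suc m) s. wt w xs * real (count_list xs d))
   = (if d \<le> s then real (Suc m) * w d * tot w m (s - d) else 0)"
  using sum_choose_count[of w d 1 "Suc m" s] by simp

text \<open>At least \<open>Suc m - s\<close> entries are zero, while \<open>sum_count\<close> gives
  the weighted number of zeros exactly.\<close>

lemma tot_zeros: "(real (Suc m) - real s) * tot w (Suc m) s \<le> real (Suc m) * w 0 * tot w m s"
proof -
  have "(real (Suc m) - real s) * tot w (Suc m) s
      = (\<Sum>xs\<in>comps (Suc m) s. wt w xs * (real (Suc m) - real s))"
    by (simp add: tot_def sum_distrib_left mult.commute)
  also have "\<dots> \<le> (\<Sum>xs\<in>comps (Suc m) s. wt w xs * real (count_list xs 0))"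
  proof (intro sum_mono mult_left_mono)
    fix xs assume "xs \<in> comps (Suc m) s"
    then have "Suc m \<le> count_list xs 0 + s"
      using length_le_zeros_plus_sum[of xs] by (simp add: comps_def)
    then have "real (Suc m) \<le> real (count_list xs 0) + real s"
      by (metis of_nat_add of_nat_le_iff)
    then show "real (Suc m) - real s \<le> real (count_list xs 0)" by simp
  qed (simp add: wt_nonneg w_nonneg)
  finally show ?thesis by (simp add: sum_count)
qed

text \<open>At most \<open>Suc s\<close> entries are one when the sum is \<open>Suc s\<close>, while
  \<open>sum_count\<close> gives the weighted number of ones exactly.\<close>

lemma tot_ones: "real (Suc m) * w 1 * tot w m s \<le> real (Suc s) * tot w (Suc m) (Suc s)"
proof -
  have "real (Suc m) * w 1 * tot w m s
      = (\<Sum>xs\<in>comps (Suc m) (Suc s). wt w xs * real (count_list xs 1))"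
    by (subst sum_count) simp
  also have "\<dots> \<le> (\<Sum>xs\<in>comps (Suc m) (Suc s). wt w xs * real (Suc s))"
    by (intro sum_mono mult_left_mono)
       (auto simp: comps_def wt_nonneg w_nonneg simp del: of_nat_Suc intro: order.trans[OF count_list_one_le_sum])
  finally show ?thesis by (simp add: tot_def sum_distrib_left mult.commute)
qed

text \<open>Turning a zero into a one: both sides are compared with \<open>w 0 * w 1 * m * tot w (m - 1) s\<close>.\<close>

lemma tot_step: "w 1 * (real m - real s) * tot w m s \<le> w 0 * real (Suc s) * tot w m (Suc s)"
proof (cases m)
  case 0
  have "w 1 * (real m - real s) * tot w m s \<le> 0"
    using 0 w1 by (simp add: tot_nonneg w_nonneg)
  also have "0 \<le> w 0 * real (Suc s) * tot w m (Suc s)"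
    by (simp add: tot_nonneg w_nonneg)
  finally show ?thesis .
next
  case (Suc m')
  have "w 1 * ((real m - real s) * tot w m s) \<le> w 1 * (real m * w 0 * tot w m' s)"
    using tot_zeros[of m' s] w1 by (intro mult_left_mono) (simp_all add: Suc)
  also have "\<dots> = w 0 * (real m * w 1 * tot w m' s)" by simp
  also have "\<dots> \<le> w 0 * (real (Suc s) * tot w m (Suc s))"
    using tot_ones[of m' s] w0 by (intro mult_left_mono) (simp_all add: Suc)
  finally show ?thesis by (simp add: mult.assoc)
qed

text \<open>The bound on \<open>tot w m (r - 1) / tot w m r\<close> that \<open>tot_step\<close>
  yields uniformly in \<open>1 \<le> r \<le> s\<close>; it is of order \<open>s / m\<close> when
  \<open>s = o(m)\<close>.\<close>

definition eps :: "nat \<Rightarrow> nat \<Rightarrow> real" where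
  "eps m s = w 0 * real s / (w 1 * (real m - real s))"

lemma eps_nonneg: "s < m \<Longrightarrow> eps m s \<ge> 0"
  using w0 w1 by (simp add: eps_def)

lemma tot_geometric:
  assumes "s < m" "j \<le> s"
  shows "tot w m (s - j) \<le> eps m s ^ j * tot w m s"
  using assms(2)
proof (induction j)
  case (Suc j)
  define r where "r = s - Suc j"
  have r: "s - j = Suc r" "Suc r \<le> s" "r \<le> s" using Suc.prems by (auto simp: r_def)
  have "w 1 * (real m - real s) * tot w m r \<le> w 1 * (real m - real r) * tot w m r"
    using w1 r by (intro mult_right_mono mult_left_mono) (auto simp: tot_nonneg w_nonneg)
  also have "\<dots> \<le> w 0 * real (Suc r) * tot w m (Suc r)" by (rule tot_step)
  also have "\<dots> \<le> w 0 * real s * tot w m (Suc r)"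
    using w0 r by (intro mult_right_mono mult_left_mono) (auto simp: tot_nonneg w_nonneg simp del: of_nat_Suc)
  finally have "tot w m r \<le> eps m s * tot w m (Suc r)"
    using w1 assms(1) by (simp add: eps_def field_simps)
  also have "\<dots> \<le> eps m s * (eps m s ^ j * tot w m s)"
    using Suc.IH Suc.prems r eps_nonneg[OF assms(1)] by (intro mult_left_mono) auto
  finally show ?case by (simp add: r_def mult.assoc)
qed simp

text \<open>This is \<open>z (F^(m + 1))' = (m + 1) z F' F^m\<close> for the generating function \<open>F\<close> of \<open>w\<close>.\<close>

lemma tot_derivative:
  "real s * tot w (Suc m) s = real (Suc m) * (\<Sum>j\<le>s. real j * w j * tot w m (s - j))"
proof -
  have "(\<Sum>j\<le>s. real j * w j * tot w m (s - j)) = (\<Sum>xs\<in>comps (Suc m) s. wt w xs * 1 * real (xs ! 0))"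
    by (simp add: sum_comps_Suc tot_def sum_distrib_left mult_ac)
  then show ?thesis
    using sum_comps_hd[of "Suc m" w "\<lambda>_. 1" s] by (simp add: tot_def)
qed

text \<open>A converse to \<open>tot_ones\<close>: in \<open>tot_derivative\<close> the term
  \<open>j = 1\<close> dominates. By \<open>real j * w j \<le> 2 ^ j\<close> the terms
  \<open>j \<ge> 2\<close> are bounded by a geometric series of ratio
  \<open>2 * eps \<le> 1 / 2\<close>, whose sum is at most \<open>2 * (2 * eps)^2\<close>; hence the
  8.\<close>

lemma tot_ones_lower:
  assumes "1 \<le> s" "s < Suc m" "eps (Suc m) s \<le> 1 / 4"
  shows "real s * tot w (Suc m) s
    \<le> real (Suc m) * w 1 * tot w m (s - 1) + real (Suc m) / w 0 * (8 * eps (Suc m) s ^ 2) * tot w (Suc m) s"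
proof -
  let ?e = "eps (Suc m) s"
  have e: "?e \<ge> 0" by (rule eps_nonneg) fact
  have "{..s} = insert 0 (insert 1 {2..s})" using assms by auto
  then have "(\<Sum>j\<le>s. real j * w j * tot w m (s - j))
      = w 1 * tot w m (s - 1) + (\<Sum>j=2..s. real j * w j * tot w m (s - j))"
    by simp
  also have "(\<Sum>j=2..s. real j * w j * tot w m (s - j)) \<le> (\<Sum>j=2..s. (2 * ?e) ^ j * (tot w (Suc m) s / w 0))"
  proof (rule sum_mono)
    fix j assume j: "j \<in> {2..s}"
    \<comment> \<open>Prefixing a zero compares length \<open>m\<close> with length
      \<open>Suc m\<close>; this is where \<open>1 / w 0\<close> comes from.\<close>
    have "tot w m (s - j) \<le> tot w (Suc m) (s - j) / w 0"
      using tot_Suc_ge[of 0 "s - j" m] w0 by (simp add: field_simps)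
    also have "\<dots> \<le> ?e ^ j * tot w (Suc m) s / w 0"
      using tot_geometric[of s "Suc m" j] j assms w0 by (intro divide_right_mono) auto
    finally have *: "tot w m (s - j) \<le> ?e ^ j * tot w (Suc m) s / w 0" .
    have "real j \<le> 2 ^ j" using of_nat_less_two_power[of j, where ?'a = real] by simp
    then have "real j * w j \<le> 2 ^ j * 1"
      by (intro mult_mono) (auto simp: w_nonneg w_le_1)
    then have "real j * w j * tot w m (s - j) \<le> 2 ^ j * (?e ^ j * tot w (Suc m) s / w 0)"
      using * by (intro mult_mono) (auto simp: tot_nonneg w_nonneg)
    then show "real j * w j * tot w m (s - j) \<le> (2 * ?e) ^ j * (tot w (Suc m) s / w 0)"
      by (simp add: power_mult_distrib)
  qed
  also have "\<dots> = (\<Sum>j=2..s. (2 * ?e) ^ j) * (tot w (Suc m) s / w 0)"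
    by (rule sum_distrib_right[symmetric])
  also have "\<dots> \<le> (2 * (2 * ?e) ^ 2) * (tot w (Suc m) s / w 0)"
    using e assms w0 by (intro mult_right_mono sum_power_le) (auto simp: tot_nonneg w_nonneg)
  finally have "(\<Sum>j\<le>s. real j * w j * tot w m (s - j))
      \<le> w 1 * tot w m (s - 1) + (8 * ?e ^ 2) * (tot w (Suc m) s / w 0)"
    by (simp add: power_mult_distrib)
  then have "real (Suc m) * (\<Sum>j\<le>s. real j * w j * tot w m (s - j))
      \<le> real (Suc m) * (w 1 * tot w m (s - 1) + (8 * ?e ^ 2) * (tot w (Suc m) s / w 0))"
    by (intro mult_left_mono) auto
  then show ?thesis
    unfolding tot_derivative[symmetric] by (simp add: distrib_left mult_ac del: of_nat_Suc)
qed

end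

section \<open>Ratios of total weights when the sum is negligible against the length\<close>

definition sparse :: "(nat \<Rightarrow> nat) \<Rightarrow> (nat \<Rightarrow> nat) \<Rightarrow> bool" where
  "sparse m s \<longleftrightarrow> filterlim m at_top sequentially \<and> filterlim s at_top sequentially \<and>
     (\<lambda>n. real (s n) / real (m n)) \<longlonglongrightarrow> 0"

lemma filterlim_diff_nat_at_top:
  fixes f :: "'a \<Rightarrow> nat"
  assumes "filterlim f at_top F"
  shows "filterlim (\<lambda>x. f x - c) at_top F"
  unfolding filterlim_at_top
proof
  fix Z
  have "eventually (\<lambda>x. f x \<ge> Z + c) F" using assms by (auto simp: filterlim_at_top)
  then show "eventually (\<lambda>x. Z \<le> f x - c) F" by eventually_elim auto
qed

lemma tendsto_diff_one_ratio:
  fixes f :: "'a \<Rightarrow> nat"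
  assumes "filterlim f at_top F"
  shows "((\<lambda>x. real (f x - c) / real (f x)) \<longlongrightarrow> 1) F"
proof -
  have "((\<lambda>n::nat. real (n - c) / real n) \<longlongrightarrow> 1) at_top"
  proof (rule Lim_transform_eventually)
    show "((\<lambda>n::nat. 1 - real c * (1 / real n)) \<longlonglongrightarrow> 1)"
      using tendsto_diff[OF tendsto_const[of 1] tendsto_mult_right_zero[OF lim_1_over_n, of "real c"]] by simp
    show "eventually (\<lambda>n. 1 - real c * (1 / real n) = real (n - c) / real n) sequentially"
      using eventually_ge_at_top[of "Suc c"]
      by eventually_elim (auto simp: of_nat_diff field_simps)
  qed
  then show ?thesis using assms by (rule filterlim_compose)
qed

lemma sparse_eventually:
  assumes "sparse m s"
  shows "eventually (\<lambda>n. m n \<ge> b \<and> s n \<ge> b \<and> s n < m n) sequentially"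
proof -
  have "eventually (\<lambda>n. real (s n) / real (m n) < 1) sequentially"
    using assms by (auto simp: sparse_def order_tendsto_iff)
  moreover have "eventually (\<lambda>n. m n \<ge> Suc b) sequentially" "eventually (\<lambda>n. s n \<ge> b) sequentially"
    using assms by (auto simp: sparse_def filterlim_at_top)
  ultimately show ?thesis by eventually_elim auto
qed

lemma sparse_diff_right:
  assumes "sparse m s" shows "sparse m (\<lambda>n. s n - c)"
proof -
  have "(\<lambda>n. real (s n - c) / real (m n)) \<longlonglongrightarrow> 0"
  proof (rule tendsto_sandwich[OF _ _ tendsto_const])
    show "(\<lambda>n. real (s n) / real (m n)) \<longlonglongrightarrow> 0" using assms by (simp add: sparse_def)
  qed (auto intro!: always_eventually divide_right_mono)
  then show ?thesis
    using assms filterlim_diff_nat_at_top unfolding sparse_def by blast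
qed

lemma sparse_diff_left:
  assumes "sparse m s" shows "sparse (\<lambda>n. m n - 1) s"
proof -
  have *: "(\<lambda>n. real (s n) / real (m n) / (real (m n - 1) / real (m n))) \<longlonglongrightarrow> 0 / 1"
    using assms by (intro tendsto_divide tendsto_diff_one_ratio) (auto simp: sparse_def)
  have "(\<lambda>n. real (s n) / real (m n - 1)) \<longlonglongrightarrow> 0"
    by (rule Lim_transform_eventually[OF *[simplified]])
       (use sparse_eventually[OF assms, of 2] in eventually_elim, auto)
  then show ?thesis
    using assms filterlim_diff_nat_at_top unfolding sparse_def by blast
qed

lemma tendsto_binomial_ratio:
  "(\<lambda>n. real (n choose r) / real n ^ r) \<longlonglongrightarrow> 1 / fact r"
proof (rule Lim_transform_eventually)
  have "(\<lambda>n. (\<Prod>i<r. real (n - i) / real n) / fact r) \<longlonglongrightarrow> (\<Prod>i<r. 1) / fact r"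
    by (intro tendsto_divide tendsto_prod tendsto_diff_one_ratio filterlim_ident tendsto_const) auto
  then show "(\<lambda>n. (\<Prod>i<r. real (n - i) / real n) / fact r) \<longlonglongrightarrow> 1 / fact r" by simp
  show "eventually (\<lambda>n. (\<Prod>i<r. real (n - i) / real n) / fact r = real (n choose r) / real n ^ r) sequentially"
    using eventually_ge_at_top[of "Suc r"]
  proof eventually_elim
    case (elim n)
    have "real (n choose r) = (\<Prod>i<r. real (n - i)) / fact r"
      unfolding binomial_gbinomial gbinomial_prod_rev using elim
      by (auto simp: atLeast0LessThan of_nat_diff intro!: arg_cong2[of _ _ _ _ "(/)"] prod.cong)
    then show ?case by (simp add: prod_dividef)
  qed
qed

context weights
begin

text \<open>The lower bound is \<open>tot_zeros\<close>; the upper one comes from prefixing a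
  zero.\<close>

lemma tendsto_tot_zeros:
  assumes "sparse m s"
  shows "(\<lambda>n. tot w (m n - 1) (s n) / tot w (m n) (s n)) \<longlonglongrightarrow> 1 / w 0"
proof (rule tendsto_sandwich)
  have "(\<lambda>n. (1 - real (s n) / real (m n)) / w 0) \<longlonglongrightarrow> (1 - 0) / w 0"
    using assms w0 by (intro tendsto_intros) (auto simp: sparse_def)
  then show "(\<lambda>n. (1 - real (s n) / real (m n)) / w 0) \<longlonglongrightarrow> 1 / w 0" by simp
  show "eventually (\<lambda>n. (1 - real (s n) / real (m n)) / w 0 \<le> tot w (m n - 1) (s n) / tot w (m n) (s n)) sequentially"
    using sparse_eventually[OF assms, of 1]
  proof eventually_elim
    case (elim n)
    then have "tot w (m n) (s n) > 0" by (intro tot_pos) auto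
    then show ?case using tot_zeros[of "m n - 1" "s n"] w0 elim by (simp add: field_simps)
  qed
  show "eventually (\<lambda>n. tot w (m n - 1) (s n) / tot w (m n) (s n) \<le> 1 / w 0) sequentially"
    using sparse_eventually[OF assms, of 1]
  proof eventually_elim
    case (elim n)
    then have "tot w (m n) (s n) > 0" by (intro tot_pos) auto
    then show ?case using tot_Suc_ge[of 0 "s n" "m n - 1"] w0 elim by (simp add: field_simps)
  qed
qed (rule tendsto_const)

lemma tendsto_eps:
  assumes "sparse m s"
  shows "(\<lambda>n. eps (m n) (s n) * (real (m n) / real (s n))) \<longlonglongrightarrow> w 0 / w 1"
proof (rule Lim_transform_eventually)
  have "(\<lambda>n. w 0 / (w 1 * (1 - real (s n) / real (m n)))) \<longlonglongrightarrow> w 0 / (w 1 * (1 - 0))"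
    using assms w1 by (intro tendsto_intros) (auto simp: sparse_def)
  then show "(\<lambda>n. w 0 / (w 1 * (1 - real (s n) / real (m n)))) \<longlonglongrightarrow> w 0 / w 1" by simp
  show "eventually (\<lambda>n. w 0 / (w 1 * (1 - real (s n) / real (m n)))
      = eps (m n) (s n) * (real (m n) / real (s n))) sequentially"
    using sparse_eventually[OF assms, of 1]
  proof eventually_elim
    case (elim n)
    then show ?case using w1 by (simp add: eps_def field_simps)
  qed
qed

lemma tendsto_eps_0:
  assumes "sparse m s"
  shows "(\<lambda>n. eps (m n) (s n)) \<longlonglongrightarrow> 0"
proof (rule Lim_transform_eventually)
  have "(\<lambda>n. real (s n) / real (m n)) \<longlonglongrightarrow> 0" using assms by (simp add: sparse_def)
  from tendsto_mult[OF tendsto_eps[OF assms] this]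
  show "(\<lambda>n. eps (m n) (s n) * (real (m n) / real (s n)) * (real (s n) / real (m n))) \<longlonglongrightarrow> 0" by simp
  show "eventually (\<lambda>n. eps (m n) (s n) * (real (m n) / real (s n)) * (real (s n) / real (m n))
      = eps (m n) (s n)) sequentially"
    using sparse_eventually[OF assms, of 1] by eventually_elim auto
qed

lemma tendsto_tot_ones:
  assumes "sparse m s"
  shows "(\<lambda>n. tot w (m n - 1) (s n - 1) / tot w (m n) (s n) * (real (m n) / real (s n))) \<longlonglongrightarrow> 1 / w 1"
proof (rule tendsto_sandwich)
  let ?e = "\<lambda>n. eps (m n) (s n)"
  \<comment> \<open>The relative error in \<open>tot_ones_lower\<close> is of order
    \<open>eps^2 * m / s\<close>. Grouped as \<open>(eps * m / s) * eps\<close>, it is a convergent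
    factor times one that vanishes.\<close>
  have "(\<lambda>n. (1 - 8 / w 0 * (?e n * (real (m n) / real (s n))) * ?e n) / w 1) \<longlonglongrightarrow> (1 - 8 / w 0 * (w 0 / w 1) * 0) / w 1"
    using w1 by (intro tendsto_intros tendsto_eps[OF assms] tendsto_eps_0[OF assms]) auto
  then show "(\<lambda>n. (1 - 8 / w 0 * (?e n * (real (m n) / real (s n))) * ?e n) / w 1) \<longlonglongrightarrow> 1 / w 1" by simp
  have "eventually (\<lambda>n. ?e n < 1 / 4) sequentially"
    using tendsto_eps_0[OF assms] by (rule order_tendstoD) simp
  then show "eventually (\<lambda>n. (1 - 8 / w 0 * (?e n * (real (m n) / real (s n))) * ?e n) / w 1
      \<le> tot w (m n - 1) (s n - 1) / tot w (m n) (s n) * (real (m n) / real (s n))) sequentially"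
    using sparse_eventually[OF assms, of 1]
  proof eventually_elim
    case (elim n)
    define T T' M S e where "T = tot w (m n) (s n)" and "T' = tot w (m n - 1) (s n - 1)"
      and "M = real (m n)" and "S = real (s n)" and "e = ?e n"
    have "T > 0" unfolding T_def using elim by (intro tot_pos) auto
    have "S > 0" "M > 0" using elim by (auto simp: S_def M_def)
    have "S * T \<le> M * w 1 * T' + M / w 0 * (8 * e ^ 2) * T"
      using tot_ones_lower[of "s n" "m n - 1"] elim by (simp add: T_def T'_def M_def S_def e_def)
    then have "(S * T - M / w 0 * (8 * e ^ 2) * T) / (S * T * w 1) \<le> (M * w 1 * T') / (S * T * w 1)"
      using \<open>T > 0\<close> \<open>S > 0\<close> w1 by (intro divide_right_mono) auto
    also have "(M * w 1 * T') / (S * T * w 1) = T' / T * (M / S)"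
      using w1 by (simp add: mult.commute)
    also have "(S * T - M / w 0 * (8 * e ^ 2) * T) / (S * T * w 1) = (1 - 8 / w 0 * (e * (M / S)) * e) / w 1"
      using \<open>T > 0\<close> \<open>S > 0\<close> w1 w0 by (simp add: field_simps power2_eq_square)
    finally show ?case by (simp add: T_def T'_def M_def S_def e_def)
  qed
  show "eventually (\<lambda>n. tot w (m n - 1) (s n - 1) / tot w (m n) (s n) * (real (m n) / real (s n)) \<le> 1 / w 1) sequentially"
    using sparse_eventually[OF assms, of 1]
  proof eventually_elim
    case (elim n)
    then have "tot w (m n) (s n) > 0" by (intro tot_pos) auto
    then show ?case using tot_ones[of "m n - 1" "s n - 1"] w1 elim by (simp add: field_simps)
  qed
qed (rule tendsto_const)

text \<open>Divide the limit for deleting a one by the limit for deleting a zero, the latter taken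
  at the sum \<open>s n - 1\<close>.\<close>

lemma tendsto_tot_pred:
  assumes "sparse m s"
  shows "(\<lambda>n. tot w (m n) (s n - 1) / tot w (m n) (s n) * (real (m n) / real (s n))) \<longlonglongrightarrow> w 0 / w 1"
proof (rule Lim_transform_eventually)
  let ?A = "\<lambda>n. tot w (m n - 1) (s n - 1) / tot w (m n) (s n) * (real (m n) / real (s n))"
  let ?B = "\<lambda>n. tot w (m n - 1) (s n - 1) / tot w (m n) (s n - 1)"
  have "(\<lambda>n. ?A n / ?B n) \<longlonglongrightarrow> (1 / w 1) / (1 / w 0)"
    using w0 by (intro tendsto_divide tendsto_tot_ones tendsto_tot_zeros sparse_diff_right assms) auto
  then show "(\<lambda>n. ?A n / ?B n) \<longlonglongrightarrow> w 0 / w 1" by simp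
  show "eventually (\<lambda>n. ?A n / ?B n = tot w (m n) (s n - 1) / tot w (m n) (s n) * (real (m n) / real (s n))) sequentially"
    using sparse_eventually[OF assms, of 1]
  proof eventually_elim
    case (elim n)
    have "tot w (m n - 1) (s n - 1) > 0" "tot w (m n) (s n - 1) > 0" using elim by (auto intro!: tot_pos)
    then show ?case by simp
  qed
qed

lemma tendsto_tot_minus:
  assumes "sparse m s"
  shows "(\<lambda>n. tot w (m n) (s n - t) / tot w (m n) (s n) * (real (m n) / real (s n)) ^ t) \<longlonglongrightarrow> (w 0 / w 1) ^ t"
  using assms
proof (induction t arbitrary: s)
  case 0
  show ?case
  proof (rule Lim_transform_eventually[OF tendsto_const])
    show "eventually (\<lambda>n. (w 0 / w 1) ^ 0
        = tot w (m n) (s n - 0) / tot w (m n) (s n) * (real (m n) / real (s n)) ^ 0) sequentially"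
      using sparse_eventually[OF 0, of 1]
    proof eventually_elim
      case (elim n)
      then have "tot w (m n) (s n) > 0" by (intro tot_pos) auto
      then show ?case by simp
    qed
  qed
next
  case (Suc t)
  let ?A = "\<lambda>n. tot w (m n) (s n - 1 - t) / tot w (m n) (s n - 1) * (real (m n) / real (s n - 1)) ^ t"
  let ?B = "\<lambda>n. tot w (m n) (s n - 1) / tot w (m n) (s n) * (real (m n) / real (s n))"
  \<comment> \<open>The induction hypothesis at \<open>s n - 1\<close> is normalised by
    \<open>s n - 1\<close>; \<open>?C\<close> corrects this to \<open>s n\<close>.\<close>
  let ?C = "\<lambda>n. real (s n - 1) / real (s n)"
  show ?case
  proof (rule Lim_transform_eventually)
    have "(\<lambda>n. ?A n * ?B n * ?C n ^ t) \<longlonglongrightarrow> (w 0 / w 1) ^ t * (w 0 / w 1) * 1 ^ t"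
      using Suc.prems
      by (intro tendsto_mult tendsto_power Suc.IH sparse_diff_right tendsto_tot_pred tendsto_diff_one_ratio)
         (auto simp: sparse_def)
    then show "(\<lambda>n. ?A n * ?B n * ?C n ^ t) \<longlonglongrightarrow> (w 0 / w 1) ^ Suc t" by (simp add: mult.commute)
    show "eventually (\<lambda>n. ?A n * ?B n * ?C n ^ t
        = tot w (m n) (s n - Suc t) / tot w (m n) (s n) * (real (m n) / real (s n)) ^ Suc t) sequentially"
      using sparse_eventually[OF Suc.prems, of 2]
    proof eventually_elim
      case (elim n)
      have "tot w (m n) (s n - 1) > 0" using elim by (auto intro!: tot_pos)
      moreover have "real (s n - 1) > 0" using elim by simp
      ultimately show ?case by (simp add: power_divide mult_ac)
    qed
  qed
qed

lemma tendsto_tot_ratio: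
  assumes "sparse m s"
  shows "(\<lambda>n. tot w (m n - r) (s n - t) / tot w (m n) (s n) * (real (m n) / real (s n)) ^ t)
    \<longlonglongrightarrow> (w 0 / w 1) ^ t / w 0 ^ r"
  using assms
proof (induction r arbitrary: m)
  case 0
  then show ?case using tendsto_tot_minus by simp
next
  case (Suc r)
  let ?A = "\<lambda>n. tot w (m n - 1 - r) (s n - t) / tot w (m n - 1) (s n) * (real (m n - 1) / real (s n)) ^ t"
  let ?B = "\<lambda>n. tot w (m n - 1) (s n) / tot w (m n) (s n)"
  let ?C = "\<lambda>n. real (m n - 1) / real (m n)"
  show ?case
  proof (rule Lim_transform_eventually)
    have "(\<lambda>n. ?A n * ?B n / ?C n ^ t) \<longlonglongrightarrow> (w 0 / w 1) ^ t / w 0 ^ r * (1 / w 0) / 1 ^ t"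
      using Suc.prems
      by (intro tendsto_mult tendsto_divide tendsto_power Suc.IH sparse_diff_left tendsto_tot_zeros tendsto_diff_one_ratio)
         (auto simp: sparse_def)
    then show "(\<lambda>n. ?A n * ?B n / ?C n ^ t) \<longlonglongrightarrow> (w 0 / w 1) ^ t / w 0 ^ Suc r" by (simp add: mult.commute)
    show "eventually (\<lambda>n. ?A n * ?B n / ?C n ^ t
        = tot w (m n - Suc r) (s n - t) / tot w (m n) (s n) * (real (m n) / real (s n)) ^ t) sequentially"
      using sparse_eventually[OF Suc.prems, of 2]
    proof eventually_elim
      case (elim n)
      have "tot w (m n - 1) (s n) > 0" using elim by (auto intro!: tot_pos)
      moreover have "real (m n - 1) > 0" using elim by simp
      ultimately show ?case by (simp add: power_divide)
    qed
  qed
qed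

text \<open>Of \<open>(m / s)^(r * d)\<close> a factor \<open>m^r\<close> compensates the binomial
  coefficient, which leaves \<open>r\<close> copies of \<open>m^(d - 1) / s^d\<close>. Shortening
  the sequence by \<open>r\<close> costs one factor \<open>w 0\<close> per marked entry, hence the
  power \<open>w 0 ^ (d - 1)\<close>.\<close>

lemma tendsto_avg_choose:
  assumes "sparse m s" "d \<ge> 1"
  shows "(\<lambda>n. avg w (m n) (s n) (\<lambda>ys. real (count_list ys d choose r)) * (real (m n) ^ (d - 1) / real (s n) ^ d) ^ r)
    \<longlonglongrightarrow> (w d * w 0 ^ (d - 1) / w 1 ^ d) ^ r / fact r"
proof (rule Lim_transform_eventually)
  let ?A = "\<lambda>n. real (m n choose r) / real (m n) ^ r"
  let ?B = "\<lambda>n. tot w (m n - r) (s n - r * d) / tot w (m n) (s n) * (real (m n) / real (s n)) ^ (r * d)"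
  have "(\<lambda>n. ?A n * w d ^ r * ?B n) \<longlonglongrightarrow> 1 / fact r * w d ^ r * ((w 0 / w 1) ^ (r * d) / w 0 ^ r)"
    using assms filterlim_compose[OF tendsto_binomial_ratio, of m]
    by (intro tendsto_mult tendsto_tot_ratio tendsto_const) (auto simp: sparse_def)
  also have "1 / fact r * w d ^ r * ((w 0 / w 1) ^ (r * d) / w 0 ^ r)
      = (w d * ((w 0 / w 1) ^ d / w 0)) ^ r / fact r"
    by (simp add: power_mult_distrib power_divide power_mult mult.commute[of r d])
  also have "(w 0 / w 1) ^ d / w 0 = w 0 ^ (d - 1) / w 1 ^ d"
    using assms(2) w0 by (cases d) (auto simp: power_divide)
  finally show "(\<lambda>n. ?A n * w d ^ r * ?B n) \<longlonglongrightarrow> (w d * w 0 ^ (d - 1) / w 1 ^ d) ^ r / fact r"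
    by simp
  show "eventually (\<lambda>n. ?A n * w d ^ r * ?B n
      = avg w (m n) (s n) (\<lambda>ys. real (count_list ys d choose r)) * (real (m n) ^ (d - 1) / real (s n) ^ d) ^ r) sequentially"
    using sparse_eventually[OF assms(1), of "Suc r + r * d"]
  proof eventually_elim
    case (elim n)
    have "(real (m n) / real (s n)) ^ d = real (m n) * (real (m n) ^ (d - 1) / real (s n) ^ d)"
      using assms(2) by (cases d) (simp_all add: power_divide)
    then have "(real (m n) / real (s n)) ^ (r * d) = real (m n) ^ r * (real (m n) ^ (d - 1) / real (s n) ^ d) ^ r"
      by (metis mult.commute power_mult power_mult_distrib)
    moreover have "avg w (m n) (s n) (\<lambda>ys. real (count_list ys d choose r))
        = real (m n choose r) * w d ^ r * tot w (m n - r) (s n - r * d) / tot w (m n) (s n)"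
      unfolding avg_def sum_choose_count using elim by (simp del: mult_eq_0_iff)
    moreover have "real (m n) ^ r \<noteq> 0" using elim by simp
    ultimately show ?case by (simp add: field_simps del: power_eq_0_iff)
  qed
qed

text \<open>Union bound over the positions. By exchangeability each contributes as the first entry
  does, and the tail of that entry is geometric by \<open>tot_geometric\<close>.\<close>

lemma avg_exceeds_le:
  assumes "s < m" "eps m s \<le> 1 / 2"
  shows "avg w m s (\<lambda>ys. of_bool (\<exists>y\<in>set ys. d \<le> y)) \<le> real m / w 0 * (2 * eps m s ^ d)"
proof -
  obtain m' where m: "m = Suc m'" using assms by (cases m) auto
  have T: "tot w m s > 0" using assms by (intro tot_pos) auto
  have "(\<Sum>ys\<in>comps m s. wt w ys * of_bool (\<exists>y\<in>set ys. d \<le> y))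
      \<le> (\<Sum>ys\<in>comps m s. wt w ys * 1 * (\<Sum>i<m. of_bool (d \<le> ys ! i)))"
  proof (rule sum_mono)
    fix ys assume ys: "ys \<in> comps m s"
    have "of_bool (\<exists>y\<in>set ys. d \<le> y) \<le> (\<Sum>i<m. of_bool (d \<le> ys ! i) :: real)"
    proof (cases "\<exists>y\<in>set ys. d \<le> y")
      case True
      then obtain i where "i < m" "d \<le> ys ! i" using ys by (auto simp: in_set_conv_nth comps_def)
      then have "1 \<le> (\<Sum>i<m. of_bool (d \<le> ys ! i) :: real)"
        using member_le_sum[of i "{..<m}" "\<lambda>i. of_bool (d \<le> ys ! i) :: real"] by simp
      then show ?thesis using True by simp
    qed (auto intro: sum_nonneg)
    then show "wt w ys * of_bool (\<exists>y\<in>set ys. d \<le> y) \<le> wt w ys * 1 * (\<Sum>i<m. of_bool (d \<le> ys ! i))"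
      by (simp add: mult_left_mono wt_nonneg w_nonneg)
  qed
  also have "\<dots> = real m * (\<Sum>ys\<in>comps m s. wt w ys * of_bool (d \<le> ys ! 0))"
    using sum_comps_sum_nth[of w "\<lambda>_. 1" "\<lambda>y. of_bool (d \<le> y)" m s] by simp
  also have "(\<Sum>ys\<in>comps m s. wt w ys * of_bool (d \<le> ys ! 0)) = (\<Sum>j\<le>s. of_bool (d \<le> j) * w j * tot w m' (s - j))"
    by (simp add: m sum_comps_Suc tot_def sum_distrib_left mult_ac)
  also have "\<dots> = (\<Sum>j=d..s. w j * tot w m' (s - j))"
    by (rule sum.mono_neutral_cong_right) auto
  also have "\<dots> \<le> (\<Sum>j=d..s. eps m s ^ j * (tot w m s / w 0))"
  proof (rule sum_mono)
    fix j assume j: "j \<in> {d..s}"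
    have "w j * tot w m' (s - j) \<le> tot w m' (s - j)"
      by (simp add: mult_left_le_one_le w_nonneg w_le_1 tot_nonneg)
    also have "\<dots> \<le> tot w m (s - j) / w 0"
      using tot_Suc_ge[of 0 "s - j" m'] w0 by (simp add: field_simps m)
    also have "\<dots> \<le> eps m s ^ j * tot w m s / w 0"
      using tot_geometric[of s m j] j assms w0 by (intro divide_right_mono) auto
    finally show "w j * tot w m' (s - j) \<le> eps m s ^ j * (tot w m s / w 0)" by simp
  qed
  also have "\<dots> = (\<Sum>j=d..s. eps m s ^ j) * (tot w m s / w 0)"
    by (rule sum_distrib_right[symmetric])
  also have "\<dots> \<le> 2 * eps m s ^ d * (tot w m s / w 0)"
    using assms w0 T by (intro mult_right_mono sum_power_le eps_nonneg) auto
  finally have "(\<Sum>ys\<in>comps m s. wt w ys * of_bool (\<exists>y\<in>set ys. d \<le> y))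
      \<le> real m * (2 * eps m s ^ d * (tot w m s / w 0))"
    by (simp add: mult_left_mono)
  then show ?thesis
    using T by (simp add: avg_def field_simps)
qed

text \<open>The bound \<open>m * eps^d\<close> is of order \<open>s^d / m^(d - 1)\<close>, and it
  treats all entries of size at least \<open>d\<close> at once.\<close>

lemma tendsto_avg_exceeds:
  assumes "sparse m s" "d \<ge> 1" "(\<lambda>n. real (s n) ^ d / real (m n) ^ (d - 1)) \<longlonglongrightarrow> 0"
  shows "(\<lambda>n. avg w (m n) (s n) (\<lambda>ys. of_bool (\<exists>y\<in>set ys. d \<le> y))) \<longlonglongrightarrow> 0"
proof (rule tendsto_sandwich[OF _ _ tendsto_const])
  let ?R = "\<lambda>n. 2 / w 0 * (eps (m n) (s n) * (real (m n) / real (s n))) ^ d * (real (s n) ^ d / real (m n) ^ (d - 1))"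
  have "?R \<longlonglongrightarrow> 2 / w 0 * (w 0 / w 1) ^ d * 0"
    by (intro tendsto_mult tendsto_power tendsto_eps tendsto_const assms)
  then show "?R \<longlonglongrightarrow> 0" by simp
  have "eventually (\<lambda>n. eps (m n) (s n) < 1 / 2) sequentially"
    using tendsto_eps_0[OF assms(1)] by (rule order_tendstoD) simp
  then show "eventually (\<lambda>n. avg w (m n) (s n) (\<lambda>ys. of_bool (\<exists>y\<in>set ys. d \<le> y)) \<le> ?R n) sequentially"
    using sparse_eventually[OF assms(1), of 1]
  proof eventually_elim
    case (elim n)
    have "real (m n) ^ d = real (m n) * real (m n) ^ (d - 1)"
      using assms(2) by (cases d) auto
    then have "?R n = real (m n) / w 0 * (2 * eps (m n) (s n) ^ d)"
      using elim by (simp add: power_mult_distrib power_divide)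
    then show ?case using avg_exceeds_le[of "s n" "m n" d] elim by simp
  qed
qed (auto simp: avg_def intro!: always_eventually divide_nonneg_nonneg sum_nonneg wt_nonneg w_nonneg tot_nonneg)

end

subsection \<open>The method of moments\<close>

lemma avg_add: "avg w m s (\<lambda>x. f x + g x) = avg w m s f + avg w m s g"
  by (simp add: avg_def distrib_left sum.distrib add_divide_distrib)

lemma avg_cmult: "avg w m s (\<lambda>x. a * f x) = a * avg w m s f"
  by (simp add: avg_def sum_distrib_left mult.left_commute)

lemma avg_minus: "avg w m s (\<lambda>x. - f x) = - avg w m s f"
  using avg_cmult[of w m s "-1" f] by simp

lemma avg_sum: "avg w m s (\<lambda>x. \<Sum>i\<in>I. f i x) = (\<Sum>i\<in>I. avg w m s (f i))"
  unfolding avg_def sum_distrib_left by (subst sum.swap) (simp add: sum_divide_distrib)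

lemma (in weights) avg_mono:
  assumes "\<And>x. f x \<le> g x" shows "avg w m s f \<le> avg w m s g"
  unfolding avg_def by (intro divide_right_mono sum_mono mult_left_mono assms wt_nonneg w_nonneg tot_nonneg)

lemma (in weights) avg_nonneg:
  assumes "\<And>x. f x \<ge> 0" shows "avg w m s f \<ge> 0"
  unfolding avg_def by (intro divide_nonneg_nonneg sum_nonneg mult_nonneg_nonneg assms wt_nonneg w_nonneg tot_nonneg)

lemma (in weights) avg_abs_diff_le:
  assumes "\<And>x. \<bar>f x - g x\<bar> \<le> h x" shows "\<bar>avg w m s f - avg w m s g\<bar> \<le> avg w m s h"
proof -
  have "f x \<le> g x + h x" "g x \<le> f x + h x" for x using assms[of x] by (auto simp: abs_le_iff)
  then have "avg w m s f \<le> avg w m s (\<lambda>x. g x + h x)" "avg w m s g \<le> avg w m s (\<lambda>x. f x + h x)"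
    by (auto intro: avg_mono)
  then show ?thesis by (simp add: avg_add abs_le_iff)
qed

lemma (in weights) avg_const: "s \<le> m \<Longrightarrow> avg w m s (\<lambda>_. a) = a"
  using tot_pos[of s m] by (simp add: avg_def tot_def flip: sum_distrib_right)

section \<open>Truncated inclusion-exclusion and the Poisson limit\<close>

lemma alternating_binomial_sum:
  "(\<Sum>i\<le>K. (-1) ^ i * real (Suc M choose i)) = (-1) ^ K * real (M choose K)"
  by (induction K) (simp_all add: algebra_simps)

text \<open>Factoring out \<open>N choose j\<close> leaves a truncated alternating row sum for
  \<open>N - j\<close>, which \<open>alternating_binomial_sum\<close> evaluates. The error is thus
  at most the first omitted term.\<close>

lemma bonferroni:
  "\<bar>of_bool (N = j) - (\<Sum>i\<le>K. (-1) ^ i * real (j + i choose j) * real (N choose (j + i)))\<bar>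
   \<le> real (j + Suc K choose j) * real (N choose (j + Suc K))"
proof -
  have eq: "real (j + i choose j) * real (N choose (j + i)) = real (N choose j) * real (N - j choose i)" for i
  proof (cases "j + i \<le> N")
    case True
    then show ?thesis using choose_mult[of j "j + i" N] by (simp add: mult.commute flip: of_nat_mult)
  next
    case False
    then show ?thesis by (cases "j \<le> N") (auto simp: binomial_eq_0 not_le)
  qed
  have sum: "(\<Sum>i\<le>K. (-1) ^ i * real (j + i choose j) * real (N choose (j + i)))
      = real (N choose j) * (\<Sum>i\<le>K. (-1) ^ i * real (N - j choose i))"
    unfolding mult.assoc eq by (simp add: sum_distrib_left mult_ac)
  consider "N < j" | "N = j" | "j < N" by linarith
  then show ?thesis
  proof cases
    case 2
    have "(\<Sum>i\<le>K. (-1) ^ i * real (0 choose i)) = (\<Sum>i\<in>{0}. (-1) ^ i * real (0 choose i))"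
      by (rule sum.mono_neutral_right) auto
    then show ?thesis unfolding sum by (simp add: 2)
  next
    case 3
    then obtain M where M: "N - j = Suc M" by (metis Suc_diff_Suc)
    have "\<bar>of_bool (N = j) - real (N choose j) * ((-1) ^ K * real (M choose K))\<bar>
        = real (N choose j) * real (M choose K)"
      using 3 by (simp add: abs_mult power_abs)
    also have "\<dots> \<le> real (N choose j) * real (Suc M choose Suc K)"
      by (intro mult_left_mono) auto
    finally show ?thesis unfolding sum eq M alternating_binomial_sum .
  qed (simp add: sum binomial_eq_0)
qed

lemma (in weights) tendsto_poisson:
  fixes X :: "nat list \<Rightarrow> nat"
  assumes "\<And>r. (\<lambda>n. avg w (m n) (s n) (\<lambda>x. real (X x choose r))) \<longlonglongrightarrow> L ^ r / fact r"
  shows "(\<lambda>n. avg w (m n) (s n) (\<lambda>x. of_bool (X x = j))) \<longlonglongrightarrow> L ^ j / fact j * exp (- L)"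
proof (rule tendstoI)
  fix e :: real assume "e > 0"
  \<comment> \<open>\<open>P K\<close> and \<open>R K\<close> are the limits in \<open>n\<close> of
    the truncated sum and of its error bound at level \<open>K\<close>.\<close>
  define P where "P K = (\<Sum>i\<le>K. (-1) ^ i * real (j + i choose j) * (L ^ (j + i) / fact (j + i)))" for K
  define R where "R K = real (j + Suc K choose j) * (L ^ (j + Suc K) / fact (j + Suc K))" for K
  have fact: "real (j + i choose j) * (L ^ (j + i) / fact (j + i)) = L ^ j / fact j * (L ^ i / fact i)" for i
    using binomial_fact[of j "j + i", where ?'a = real] by (simp add: power_add)
  have "(\<lambda>K. \<Sum>i\<le>K. (- L) ^ i /\<^sub>R fact i) \<longlonglongrightarrow> exp (- L)"
    using exp_converges[of "- L"] by (simp add: sums_def_le)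
  then have "(\<lambda>K. L ^ j / fact j * (\<Sum>i\<le>K. (- L) ^ i /\<^sub>R fact i)) \<longlonglongrightarrow> L ^ j / fact j * exp (- L)"
    by (intro tendsto_intros)
  also have "(\<lambda>K. L ^ j / fact j * (\<Sum>i\<le>K. (- L) ^ i /\<^sub>R fact i)) = P"
    unfolding P_def mult.assoc fact
    by (rule ext) (simp add: sum_distrib_left power_minus[of L] field_simps)
  finally have P: "P \<longlonglongrightarrow> L ^ j / fact j * exp (- L)" .
  have "(\<lambda>K. L ^ Suc K /\<^sub>R fact (Suc K)) \<longlonglongrightarrow> 0"
    using summable_LIMSEQ_zero[OF summable_exp_generic[of L]] by (rule LIMSEQ_Suc)
  then have "(\<lambda>K. L ^ j / fact j * (L ^ Suc K /\<^sub>R fact (Suc K))) \<longlonglongrightarrow> L ^ j / fact j * 0"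
    by (intro tendsto_intros)
  also have "(\<lambda>K. L ^ j / fact j * (L ^ Suc K /\<^sub>R fact (Suc K))) = R"
    unfolding R_def fact by (simp add: divide_inverse mult.commute)
  finally have R: "R \<longlonglongrightarrow> 0" by simp
  have "(\<lambda>K. R K + \<bar>P K - L ^ j / fact j * exp (- L)\<bar>) \<longlonglongrightarrow> 0 + \<bar>L ^ j / fact j * exp (- L) - L ^ j / fact j * exp (- L)\<bar>"
    by (intro tendsto_intros P R)
  then have "eventually (\<lambda>K. R K + \<bar>P K - L ^ j / fact j * exp (- L)\<bar> < e) sequentially"
    using \<open>e > 0\<close> by (auto simp: order_tendsto_iff)
  \<comment> \<open>\<open>K\<close> is fixed before \<open>n\<close>, so that only finitely many
    binomial moments have to converge.\<close>
  then obtain K where K: "R K + \<bar>P K - L ^ j / fact j * exp (- L)\<bar> < e"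
    by (auto simp: eventually_sequentially)
  let ?E = "\<lambda>n. avg w (m n) (s n)"
  define Pn where "Pn n = (\<Sum>i\<le>K. (-1) ^ i * real (j + i choose j) * ?E n (\<lambda>x. real (X x choose (j + i))))" for n
  define Rn where "Rn n = real (j + Suc K choose j) * ?E n (\<lambda>x. real (X x choose (j + Suc K)))" for n
  have "(\<lambda>n. Rn n + \<bar>Pn n - L ^ j / fact j * exp (- L)\<bar>) \<longlonglongrightarrow> R K + \<bar>P K - L ^ j / fact j * exp (- L)\<bar>"
    unfolding Rn_def Pn_def P_def R_def by (intro tendsto_intros assms)
  then have "eventually (\<lambda>n. Rn n + \<bar>Pn n - L ^ j / fact j * exp (- L)\<bar> < e) sequentially"
    using K by (auto simp: order_tendsto_iff)
  then show "eventually (\<lambda>n. dist (?E n (\<lambda>x. of_bool (X x = j))) (L ^ j / fact j * exp (- L)) < e) sequentially"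
  proof eventually_elim
    case (elim n)
    have "\<bar>?E n (\<lambda>x. of_bool (X x = j)) - Pn n\<bar> \<le> Rn n"
      unfolding Pn_def Rn_def avg_cmult[symmetric] avg_sum[symmetric]
      by (rule avg_abs_diff_le) (rule bonferroni)
    then show ?case using elim by (simp add: dist_real_def)
  qed
qed

text \<open>Since \<open>X * (X choose j) = j * (X choose j) + (j + 1) * (X choose (j + 1))\<close>,
  a power of \<open>X\<close> can be traded for a higher \<open>j\<close>. The first summand is left
  with a surplus factor \<open>c n\<close> and vanishes. The case \<open>j = 0\<close> gives the
  ordinary moments.\<close>

lemma (in weights) tendsto_moments:
  fixes X :: "nat list \<Rightarrow> nat" and c :: "nat \<Rightarrow> real"
  assumes X: "\<And>r. (\<lambda>n. avg w (m n) (s n) (\<lambda>x. real (X x choose r)) * c n ^ r) \<longlonglongrightarrow> L ^ r / fact r"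
    and c: "c \<longlonglongrightarrow> 0"
  shows "(\<lambda>n. avg w (m n) (s n) (\<lambda>x. real (X x choose j) * real (X x) ^ i) * c n ^ (j + i)) \<longlonglongrightarrow> L ^ (j + i) / fact j"
proof (induction i arbitrary: j)
  case 0
  then show ?case using X by simp
next
  case (Suc i)
  let ?E = "\<lambda>n j i. avg w (m n) (s n) (\<lambda>x. real (X x choose j) * real (X x) ^ i)"
  have "real N * real (N choose j) = real j * real (N choose j) + real (Suc j) * real (N choose Suc j)" for N
    using gbinomial_mult_1[of "real N" j] by (simp only: binomial_gbinomial)
  then have "real (N choose j) * real N ^ Suc i
      = real j * (real (N choose j) * real N ^ i) + real (Suc j) * (real (N choose Suc j) * real N ^ i)" for N
    by (metis (no_types, opaque_lifting) distrib_right mult.assoc mult.commute power_Suc)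
  then have eq: "?E n j (Suc i) * c n ^ (j + Suc i)
      = real j * (?E n j i * c n ^ (j + i)) * c n + real (Suc j) * (?E n (Suc j) i * c n ^ (Suc j + i))" for n
    by (simp only: avg_add avg_cmult) (simp add: algebra_simps)
  have "(\<lambda>n. ?E n j (Suc i) * c n ^ (j + Suc i)) \<longlonglongrightarrow>
      real j * (L ^ (j + i) / fact j) * 0 + real (Suc j) * (L ^ (Suc j + i) / fact (Suc j))"
    unfolding eq by (intro tendsto_intros Suc.IH c)
  also have "real (Suc j) * (L ^ (Suc j + i) / fact (Suc j)) = L ^ (j + Suc i) / fact j"
    by (simp add: fact_Suc del: of_nat_Suc)
  finally show ?case by simp
qed

text \<open>For \<open>\<bar>x\<bar> \<le> \<epsilon>\<close> the first term suffices; otherwise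
  raising the exponent from \<open>p\<close> to \<open>2 * q\<close> enlarges the power of
  \<open>\<bar>x\<bar> / \<epsilon>\<close>. This reduces a real exponent to an even one, for which
  the power is a polynomial in \<open>x\<close>.\<close>

lemma powr_le_power:
  fixes x \<epsilon> p :: real
  assumes "\<epsilon> > 0" "p > 0" "p \<le> 2 * real q"
  shows "\<bar>x\<bar> powr p \<le> \<epsilon> powr p + \<epsilon> powr p / \<epsilon> ^ (2 * q) * x ^ (2 * q)"
proof (cases "\<bar>x\<bar> \<le> \<epsilon>")
  case True
  have "\<bar>x\<bar> powr p \<le> \<epsilon> powr p" using True assms by (intro powr_mono2) auto
  moreover have "0 \<le> \<epsilon> powr p / \<epsilon> ^ (2 * q) * x ^ (2 * q)" using assms by simp
  ultimately show ?thesis by linarith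
next
  case False
  then have "(\<bar>x\<bar> / \<epsilon>) powr p \<le> (\<bar>x\<bar> / \<epsilon>) powr (2 * real q)" using assms by (intro powr_mono) auto
  also have "\<dots> = (\<bar>x\<bar> / \<epsilon>) ^ (2 * q)"
    using False assms by (subst powr_realpow[symmetric]) auto
  finally have "\<bar>x\<bar> powr p / \<epsilon> powr p \<le> x ^ (2 * q) / \<epsilon> ^ (2 * q)"
    using assms by (simp add: powr_divide power_divide power_even_abs)
  then have "\<bar>x\<bar> powr p \<le> \<epsilon> powr p / \<epsilon> ^ (2 * q) * x ^ (2 * q)"
    using assms by (simp add: field_simps)
  then show ?thesis by (simp add: add_increasing)
qed

lemma (in weights) tendsto_Lp:
  fixes X :: "nat list \<Rightarrow> nat" and c :: "nat \<Rightarrow> real" and p :: real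
  assumes X: "\<And>r. (\<lambda>n. avg w (m n) (s n) (\<lambda>x. real (X x choose r)) * c n ^ r) \<longlonglongrightarrow> L ^ r / fact r"
    and c: "c \<longlonglongrightarrow> 0" and ms: "eventually (\<lambda>n. s n \<le> m n) sequentially" and p: "p > 0"
  shows "(\<lambda>n. avg w (m n) (s n) (\<lambda>x. \<bar>c n * real (X x) - L\<bar> powr p)) \<longlonglongrightarrow> 0"
proof -
  let ?E = "\<lambda>n. avg w (m n) (s n)"
  define q where "q = nat \<lceil>p\<rceil>"
  have q: "p \<le> 2 * real q" using p unfolding q_def by linarith
  \<comment> \<open>Binomial expansion of the even moment: the limits of its terms recombine to
    \<open>(L - L)^(2 * q)\<close>, which is 0 because \<open>q > 0\<close>.\<close>
  have "(\<lambda>n. \<Sum>i\<le>2*q. real (2 * q choose i) * (-L) ^ (2 * q - i) * (?E n (\<lambda>x. real (X x) ^ i) * c n ^ i))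
      \<longlonglongrightarrow> (\<Sum>i\<le>2*q. real (2 * q choose i) * (-L) ^ (2 * q - i) * L ^ i)"
    using tendsto_moments[OF X c, of 0] by (intro tendsto_intros) simp_all
  also have "(\<Sum>i\<le>2*q. real (2 * q choose i) * (-L) ^ (2 * q - i) * L ^ i) = (L + (- L)) ^ (2 * q)"
    unfolding binomial_ring by (simp add: mult_ac)
  also have "\<dots> = 0" using p by (simp add: q_def)
  also have "(\<lambda>n. \<Sum>i\<le>2*q. real (2 * q choose i) * (-L) ^ (2 * q - i) * (?E n (\<lambda>x. real (X x) ^ i) * c n ^ i))
      = (\<lambda>n. ?E n (\<lambda>x. (c n * real (X x) - L) ^ (2 * q)))"
  proof (rule ext)
    fix n
    have "(c n * real (X x) - L) ^ (2 * q)
        = (\<Sum>i\<le>2*q. (real (2 * q choose i) * (-L) ^ (2 * q - i) * c n ^ i) * real (X x) ^ i)" for x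
      using binomial_ring[of "c n * real (X x)" "-L" "2 * q"] by (simp add: power_mult_distrib mult_ac)
    then show "(\<Sum>i\<le>2*q. real (2 * q choose i) * (-L) ^ (2 * q - i) * (?E n (\<lambda>x. real (X x) ^ i) * c n ^ i))
        = ?E n (\<lambda>x. (c n * real (X x) - L) ^ (2 * q))"
      by (simp only: avg_sum avg_cmult) (simp add: mult_ac)
  qed
  finally have lim: "(\<lambda>n. ?E n (\<lambda>x. (c n * real (X x) - L) ^ (2 * q))) \<longlonglongrightarrow> 0" .
  show ?thesis
  proof (rule tendstoI)
    fix e :: real assume e: "e > 0"
    \<comment> \<open>Chosen so that \<open>\<epsilon> powr p\<close> is half of the allowed
      error.\<close>
    define \<epsilon> where "\<epsilon> = (e / 2) powr (1 / p)"
    have \<epsilon>: "\<epsilon> > 0" "\<epsilon> powr p = e / 2" using e p by (auto simp: \<epsilon>_def powr_powr)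
    have "(\<lambda>n. e / 2 + e / 2 / \<epsilon> ^ (2 * q) * ?E n (\<lambda>x. (c n * real (X x) - L) ^ (2 * q)))
        \<longlonglongrightarrow> e / 2 + e / 2 / \<epsilon> ^ (2 * q) * 0"
      by (intro tendsto_intros lim)
    then have "eventually (\<lambda>n. e / 2 + e / 2 / \<epsilon> ^ (2 * q) * ?E n (\<lambda>x. (c n * real (X x) - L) ^ (2 * q)) < e) sequentially"
      by (rule order_tendstoD) (use e in simp)
    with ms show "eventually (\<lambda>n. dist (?E n (\<lambda>x. \<bar>c n * real (X x) - L\<bar> powr p)) 0 < e) sequentially"
    proof eventually_elim
      case (elim n)
      have "?E n (\<lambda>x. \<bar>c n * real (X x) - L\<bar> powr p)
          \<le> ?E n (\<lambda>x. e / 2 + e / 2 / \<epsilon> ^ (2 * q) * (c n * real (X x) - L) ^ (2 * q))"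
        using powr_le_power[OF \<epsilon>(1) p q] by (intro avg_mono) (simp add: \<epsilon>(2))
      also have "\<dots> = e / 2 + e / 2 / \<epsilon> ^ (2 * q) * ?E n (\<lambda>x. (c n * real (X x) - L) ^ (2 * q))"
        by (simp only: avg_add avg_cmult avg_const[OF elim(1)])
      also have "\<dots> < e" by fact
      finally show ?case by (simp add: avg_nonneg)
    qed
  qed
qed

text \<open>At rate zero the formula gives the Dirac mass through \<open>0 ^ 0 = 1\<close>.\<close>

lemma pmf_Poi: "r \<ge> 0 \<Longrightarrow> pmf (Poi r) j = r ^ j / fact j * exp (- r)"
  by (cases "r = 0") (auto simp: Poi_def power_0_left indicator_def)

subsection \<open>Passage to the limit\<close>

text \<open>Raising to the power \<open>d\<close> removes the fractional exponent. The first claim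
  uses \<open>c = 1\<close> and \<open>l = 0\<close>, the second \<open>l = 1\<close>.\<close>

lemma tendsto_power_ratio:
  fixes k :: "nat \<Rightarrow> nat"
  assumes "(\<lambda>n. real (k n) / (c * real n powr ((real d - 1) / real d))) \<longlonglongrightarrow> l" "d \<ge> 1" "c > 0"
  shows "(\<lambda>n. real (k n) ^ d / real n ^ (d - 1)) \<longlonglongrightarrow> c ^ d * l ^ d"
proof (rule Lim_transform_eventually)
  show "(\<lambda>n. c ^ d * (real (k n) / (c * real n powr ((real d - 1) / real d))) ^ d) \<longlonglongrightarrow> c ^ d * l ^ d"
    by (intro tendsto_intros assms)
  show "eventually (\<lambda>n. c ^ d * (real (k n) / (c * real n powr ((real d - 1) / real d))) ^ d
      = real (k n) ^ d / real n ^ (d - 1)) sequentially"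
    using eventually_ge_at_top[of 1]
  proof eventually_elim
    case (elim n)
    have "(real n powr ((real d - 1) / real d)) ^ d = real n powr ((real d - 1) / real d * real d)"
      using elim by (simp add: powr_powr flip: powr_realpow)
    also have "(real d - 1) / real d * real d = real (d - 1)" using assms(2) by (simp add: of_nat_diff)
    also have "real n powr real (d - 1) = real n ^ (d - 1)" using elim by (simp add: powr_realpow)
    finally show ?case using assms(3) by (simp add: power_divide power_mult_distrib)
  qed
qed

text \<open>The distribution function at \<open>x\<close> is a finite sum of point masses, so their
  convergence gives convergence at every \<open>x\<close>. The second assumption is only eventual
  because the conditioning event may be null for small \<open>n\<close>.\<close>

lemma weak_conv_m_nat:
  assumes "\<And>j. (\<lambda>n. p n j) \<longlonglongrightarrow> pmf q j"
    and "eventually (\<lambda>n. \<forall>x. cdf (M n) x = (\<Sum>j | real j \<le> x. p n j)) sequentially"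
  shows "weak_conv_m M (distr (measure_pmf q) borel real)"
  unfolding weak_conv_m_def weak_conv_def
proof (intro allI impI)
  fix x :: real
  have "{j. real j \<le> x} \<subseteq> {..nat \<lfloor>x\<rfloor>}" by (auto simp: le_nat_floor)
  then have fin: "finite {j. real j \<le> x}" by (rule finite_subset) simp
  have "cdf (distr (measure_pmf q) borel real) x = measure q {j. real j \<le> x}"
    unfolding cdf_def by (subst measure_distr) (auto simp: vimage_def)
  also have "\<dots> = (\<Sum>j | real j \<le> x. pmf q j)"
    by (rule measure_measure_pmf_finite) (rule fin)
  finally have q: "cdf (distr (measure_pmf q) borel real) x = (\<Sum>j | real j \<le> x. pmf q j)" .
  show "(\<lambda>n. cdf (M n) x) \<longlonglongrightarrow> cdf (distr (measure_pmf q) borel real) x"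
  proof (rule Lim_transform_eventually)
    show "(\<lambda>n. \<Sum>j | real j \<le> x. p n j) \<longlonglongrightarrow> cdf (distr (measure_pmf q) borel real) x"
      unfolding q by (intro tendsto_sum assms)
    show "eventually (\<lambda>n. (\<Sum>j | real j \<le> x. p n j) = cdf (M n) x) sequentially"
      using assms(2) by eventually_elim simp
  qed
qed

theorem theorem1p2:
  fixes \<mu> :: "nat pmf" and k :: "nat \<Rightarrow> nat" and d :: nat
  assumes "pmf \<mu> 0 > 0" and "pmf \<mu> 1 > 0" and "pmf \<mu> 2 > 0"
    and "\<And>n. k n > 0"
    and "filterlim k at_top sequentially"
    and "(\<lambda>n. real (k n)) \<in> o(\<lambda>n. real n)"
    and "d \<ge> 2"
  shows
    "((\<lambda>n. real (k n)) \<in> o(\<lambda>n. real n powr ((real d - 1) / real d)) \<longrightarrow>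
        (\<lambda>n. \<P>(\<omega> in bgw_cond \<mu> n (k n). deg_max (bgw_tree \<omega>) \<le> d)) \<longlonglongrightarrow> 1) \<and>
     (\<forall>c::real. c > 0 \<longrightarrow>
        (\<lambda>n. real (k n)) \<sim>[sequentially] (\<lambda>n. c * real n powr ((real d - 1) / real d)) \<longrightarrow>
        weak_conv_m
          (\<lambda>n. distr (bgw_cond \<mu> n (k n)) borel (\<lambda>\<omega>. real (num_outdeg (d + 1) (bgw_tree \<omega>))))
          (distr (measure_pmf
             (Poi (c ^ d * (pmf \<mu> (d + 1) * pmf \<mu> 1 ^ (d - 1) / pmf \<mu> 2 ^ d)))) borel real)) \<and>
     (filterlim (\<lambda>n. real (k n) ^ d / real n ^ (d - 1)) at_top sequentially \<longrightarrow>
        (\<forall>p::real. p \<ge> 1 \<longrightarrow>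
          (\<lambda>n. \<integral>\<^sup>+ \<omega>. ennreal
              (\<bar>real n ^ (d - 1) / real (k n) ^ d * real (num_outdeg (d + 1) (bgw_tree \<omega>))
                 - pmf \<mu> 1 ^ (d - 1) * pmf \<mu> (d + 1) / pmf \<mu> 2 ^ d\<bar> powr p)
            \<partial>bgw_cond \<mu> n (k n)) \<longlonglongrightarrow> 0))"
proof (intro conjI allI impI)
  define w where "w = (\<lambda>j. pmf \<mu> (Suc j))"
  define m where "m n = n - k n" for n
  define s where "s n = k n - 1" for n
  define L where "L = w d * w 0 ^ (d - 1) / w 1 ^ d"
  have L: "L = pmf \<mu> (d + 1) * pmf \<mu> 1 ^ (d - 1) / pmf \<mu> 2 ^ d"
    by (simp add: L_def w_def numeral_2_eq_2)
  have "0 \<le> L" by (simp add: L)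
  have w: "(\<lambda>j. pmf \<mu> (Suc j)) = w" by (simp only: w_def)
  interpret weights w
    by unfold_locales (use assms(2,3) in \<open>simp_all add: w_def pmf_le_1 numeral_2_eq_2\<close>)
  have d: "d \<ge> 1" using assms(7) by simp

  have kn: "(\<lambda>n. real (k n) / real n) \<longlonglongrightarrow> 0" using assms(6) by (rule smalloD_tendsto)
  then have "eventually (\<lambda>n. real (k n) / real n < 1 / 2) sequentially"
    by (rule order_tendstoD) simp
  \<comment> \<open>Below one half, \<open>n - k n\<close> is not truncated and is at least
    \<open>n / 2\<close>.\<close>
  then have half: "eventually (\<lambda>n. 0 < n \<and> 2 * k n < n) sequentially"
    using eventually_ge_at_top[of 1]
  proof eventually_elim
    case (elim n)
    then have "2 * real (k n) < real n" by (simp add: field_simps)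
    then show ?case using elim by linarith
  qed
  have m: "filterlim m at_top sequentially"
    unfolding filterlim_at_top
  proof
    fix Z
    show "eventually (\<lambda>n. Z \<le> m n) sequentially"
      using half eventually_ge_at_top[of "2 * Z"] by eventually_elim (auto simp: m_def)
  qed
  have mn: "(\<lambda>n. real (m n) / real n) \<longlonglongrightarrow> 1"
  proof (rule Lim_transform_eventually)
    show "(\<lambda>n. 1 - real (k n) / real n) \<longlonglongrightarrow> 1" using tendsto_diff[OF tendsto_const[of 1] kn] by simp
    show "eventually (\<lambda>n. 1 - real (k n) / real n = real (m n) / real n) sequentially"
      using half by eventually_elim (auto simp: m_def of_nat_diff field_simps)
  qed
  have sk: "(\<lambda>n. real (s n) / real (k n)) \<longlonglongrightarrow> 1"
    unfolding s_def by (rule tendsto_diff_one_ratio) fact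
  have "(\<lambda>n. real (s n) / real (k n) * (real (k n) / real n) / (real (m n) / real n)) \<longlonglongrightarrow> 1 * 0 / 1"
    by (intro tendsto_intros sk kn mn) simp
  then have "(\<lambda>n. real (s n) / real (k n) * (real (k n) / real n) / (real (m n) / real n)) \<longlonglongrightarrow> 0" by simp
  then have "(\<lambda>n. real (s n) / real (m n)) \<longlonglongrightarrow> 0"
    by (rule Lim_transform_eventually) (use half in eventually_elim, simp add: assms(4))
  then have sp: "sparse m s"
    using m assms(5) unfolding sparse_def s_def by (auto intro: filterlim_diff_nat_at_top)
  \<comment> \<open>For these \<open>n\<close> the conditioning event has positive probability, and
    the formulas for the conditioned law apply.\<close>
  have good: "eventually (\<lambda>n. 0 < k n \<and> k n \<le> n \<and> 0 < tot w (n - k n) (k n - 1) \<and> s n \<le> m n) sequentially"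
    using sparse_eventually[OF sp, of 1] half
    by eventually_elim (auto simp: assms(4) m_def s_def intro!: tot_pos)

  \<comment> \<open>The factor between the normalisation in terms of \<open>m\<close> and
    \<open>s\<close> and the one in terms of \<open>n\<close> and \<open>k\<close>; it tends to
    1.\<close>
  define \<rho> where "\<rho> n = (real (m n) / real n) ^ (d - 1) / (real (s n) / real (k n)) ^ d" for n
  have \<rho>: "\<rho> \<longlonglongrightarrow> 1"
    unfolding \<rho>_def using tendsto_divide[OF tendsto_power[OF mn] tendsto_power[OF sk], of d "d - 1"] by simp
  have \<rho>_eq: "eventually (\<lambda>n. real (m n) ^ (d - 1) / real (s n) ^ d = real n ^ (d - 1) / real (k n) ^ d * \<rho> n \<and> \<rho> n > 0) sequentially"
    using sparse_eventually[OF sp, of 1] half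
    by eventually_elim (auto simp: \<rho>_def power_divide assms(4))
  have moments: "(\<lambda>n. avg w (m n) (s n) (\<lambda>ys. real (count_list ys d choose r)) * (real n ^ (d - 1) / real (k n) ^ d) ^ r)
      \<longlonglongrightarrow> L ^ r / fact r" for r
  proof (rule Lim_transform_eventually)
    let ?A = "\<lambda>n. avg w (m n) (s n) (\<lambda>ys. real (count_list ys d choose r))"
    have "(\<lambda>n. ?A n * (real (m n) ^ (d - 1) / real (s n) ^ d) ^ r / \<rho> n ^ r) \<longlonglongrightarrow> L ^ r / fact r / 1 ^ r"
      unfolding L_def by (intro tendsto_divide tendsto_avg_choose tendsto_power \<rho> sp d) simp
    then show "(\<lambda>n. ?A n * (real (m n) ^ (d - 1) / real (s n) ^ d) ^ r / \<rho> n ^ r) \<longlonglongrightarrow> L ^ r / fact r" by simp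
    show "eventually (\<lambda>n. ?A n * (real (m n) ^ (d - 1) / real (s n) ^ d) ^ r / \<rho> n ^ r
        = ?A n * (real n ^ (d - 1) / real (k n) ^ d) ^ r) sequentially"
      using \<rho>_eq
    proof eventually_elim
      case (elim n)
      then have "\<rho> n ^ r \<noteq> 0" by simp
      then show ?case
        by (simp only: conjunct1[OF elim] power_mult_distrib mult.assoc[symmetric] nonzero_mult_div_cancel_right
              not_False_eq_True)
    qed
  qed

  {
    assume "(\<lambda>n. real (k n)) \<in> o(\<lambda>n. real n powr ((real d - 1) / real d))"
    then have "(\<lambda>n. real (k n) / (1 * real n powr ((real d - 1) / real d))) \<longlonglongrightarrow> 0"
      using smalloD_tendsto by simp
    then have k0: "(\<lambda>n. real (k n) ^ d / real n ^ (d - 1)) \<longlonglongrightarrow> 0"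
      using tendsto_power_ratio[of k 1 d 0] d by (simp add: power_0_left)
    have "(\<lambda>n. real (s n) ^ d / real (m n) ^ (d - 1)) \<longlonglongrightarrow> 0"
    proof (rule Lim_transform_eventually)
      show "(\<lambda>n. real (k n) ^ d / real n ^ (d - 1) / \<rho> n) \<longlonglongrightarrow> 0"
        using tendsto_divide[OF k0 \<rho>] by simp
      show "eventually (\<lambda>n. real (k n) ^ d / real n ^ (d - 1) / \<rho> n = real (s n) ^ d / real (m n) ^ (d - 1)) sequentially"
        using \<rho>_eq
      proof eventually_elim
        case (elim n)
        then have "inverse (real (m n) ^ (d - 1) / real (s n) ^ d) = inverse (real n ^ (d - 1) / real (k n) ^ d * \<rho> n)"
          by (simp only:)
        then show ?case by (simp add: field_simps)
      qed
    qed
    then have "(\<lambda>n. avg w (m n) (s n) (\<lambda>ys. of_bool (\<exists>y\<in>set ys. d \<le> y))) \<longlonglongrightarrow> 0"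
      by (intro tendsto_avg_exceeds sp d)
    then have lim: "(\<lambda>n. 1 + - avg w (m n) (s n) (\<lambda>ys. of_bool (\<exists>y\<in>set ys. d \<le> y))) \<longlonglongrightarrow> 1"
      using tendsto_add[OF tendsto_const[of 1] tendsto_minus] by fastforce
    show "(\<lambda>n. \<P>(\<omega> in bgw_cond \<mu> n (k n). deg_max (bgw_tree \<omega>) \<le> d)) \<longlonglongrightarrow> 1"
    proof (rule Lim_transform_eventually[OF lim])
      show "eventually (\<lambda>n. 1 + - avg w (m n) (s n) (\<lambda>ys. of_bool (\<exists>y\<in>set ys. d \<le> y))
          = \<P>(\<omega> in bgw_cond \<mu> n (k n). deg_max (bgw_tree \<omega>) \<le> d)) sequentially"
        using good
      proof eventually_elim
        case (elim n)
        have "\<P>(\<omega> in bgw_cond \<mu> n (k n). deg_max (bgw_tree \<omega>) \<le> d)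
            = avg w (m n) (s n) (\<lambda>ys. of_bool (\<forall>y\<in>set ys. y < d))"
          using prob_deg_max_bgw_cond[of "k n" n \<mu> d] elim assms(1) by (simp add: w m_def s_def)
        also have "(\<lambda>ys. of_bool (\<forall>y\<in>set ys. y < d) :: real) = (\<lambda>ys. 1 + - of_bool (\<exists>y\<in>set ys. d \<le> y))"
          by (auto simp: fun_eq_iff of_bool_def not_less)
        also have "avg w (m n) (s n) \<dots> = 1 + - avg w (m n) (s n) (\<lambda>ys. of_bool (\<exists>y\<in>set ys. d \<le> y))"
          unfolding avg_add avg_minus using elim by (simp add: avg_const)
        finally show ?case by simp
      qed
    qed
  }

  {
    fix c :: real
    assume c: "c > 0" and asymp: "(\<lambda>n. real (k n)) \<sim>[sequentially] (\<lambda>n. c * real n powr ((real d - 1) / real d))"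
    \<comment> \<open>Asymptotic equivalence sets the ratio to 1 where both sides vanish; as
      \<open>k n > 0\<close> this never happens, and the plain quotient remains.\<close>
    have "(\<lambda>n. real (k n) / (c * real n powr ((real d - 1) / real d))) \<longlonglongrightarrow> 1"
      using asymp assms(4) unfolding asymp_equiv_def by (simp add: less_imp_neq[symmetric])
    then have kc: "(\<lambda>n. real (k n) ^ d / real n ^ (d - 1)) \<longlonglongrightarrow> c ^ d"
      using tendsto_power_ratio[of k c d 1] d c by simp
    have choose: "(\<lambda>n. avg w (m n) (s n) (\<lambda>ys. real (count_list ys d choose r))) \<longlonglongrightarrow> (c ^ d * L) ^ r / fact r" for r
    proof (rule Lim_transform_eventually)
      let ?A = "\<lambda>n. avg w (m n) (s n) (\<lambda>ys. real (count_list ys d choose r))"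
      \<comment> \<open>Here the inverse of the normalising factor tends to \<open>c ^ d\<close>, so
        the normalisation can be multiplied away.\<close>
      have "(\<lambda>n. ?A n * (real n ^ (d - 1) / real (k n) ^ d) ^ r * (real (k n) ^ d / real n ^ (d - 1)) ^ r)
          \<longlonglongrightarrow> L ^ r / fact r * (c ^ d) ^ r"
        by (intro tendsto_mult moments tendsto_power kc)
      then show "(\<lambda>n. ?A n * (real n ^ (d - 1) / real (k n) ^ d) ^ r * (real (k n) ^ d / real n ^ (d - 1)) ^ r)
          \<longlonglongrightarrow> (c ^ d * L) ^ r / fact r"
        by (simp add: power_mult_distrib mult.commute)
      show "eventually (\<lambda>n. ?A n * (real n ^ (d - 1) / real (k n) ^ d) ^ r * (real (k n) ^ d / real n ^ (d - 1)) ^ r = ?A n) sequentially"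
        using eventually_ge_at_top[of 1]
      proof eventually_elim
        case (elim n)
        then have "real n ^ (d - 1) / real (k n) ^ d * (real (k n) ^ d / real n ^ (d - 1)) = 1"
          using assms(4)[of n] by simp
        then show ?case by (simp only: mult.assoc power_mult_distrib[symmetric]) simp
      qed
    qed
    have "0 \<le> c ^ d * L" using c \<open>0 \<le> L\<close> by simp
    then have lim: "(\<lambda>n. avg w (m n) (s n) (\<lambda>ys. of_bool (count_list ys d = j))) \<longlonglongrightarrow> pmf (Poi (c ^ d * L)) j" for j
      using tendsto_poisson[OF choose] by (simp add: pmf_Poi)
    show "weak_conv_m
          (\<lambda>n. distr (bgw_cond \<mu> n (k n)) borel (\<lambda>\<omega>. real (num_outdeg (d + 1) (bgw_tree \<omega>))))
          (distr (measure_pmf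
             (Poi (c ^ d * (pmf \<mu> (d + 1) * pmf \<mu> 1 ^ (d - 1) / pmf \<mu> 2 ^ d)))) borel real)"
      unfolding L[symmetric]
    proof (rule weak_conv_m_nat[OF lim])
      show "eventually (\<lambda>n. \<forall>x. cdf (distr (bgw_cond \<mu> n (k n)) borel (\<lambda>\<omega>. real (num_outdeg (d + 1) (bgw_tree \<omega>)))) x
          = (\<Sum>j | real j \<le> x. avg w (m n) (s n) (\<lambda>ys. of_bool (count_list ys d = j)))) sequentially"
        using good
      proof (eventually_elim, intro allI)
        fix n and x :: real
        assume good: "0 < k n \<and> k n \<le> n \<and> 0 < tot w (n - k n) (k n - 1) \<and> s n \<le> m n"
        have "{j. real j \<le> x} \<subseteq> {..nat \<lfloor>x\<rfloor>}" by (auto simp: le_nat_floor)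
        then have fin: "finite {j. real j \<le> x}" by (rule finite_subset) simp
        have [measurable]: "(\<lambda>\<omega>. real (num_outdeg (d + 1) (bgw_tree \<omega>))) \<in> borel_measurable (bgw_cond \<mu> n (k n))"
          by measurable
        have "cdf (distr (bgw_cond \<mu> n (k n)) borel (\<lambda>\<omega>. real (num_outdeg (d + 1) (bgw_tree \<omega>)))) x
            = \<P>(\<omega> in bgw_cond \<mu> n (k n). real (num_outdeg (Suc d) (bgw_tree \<omega>)) \<le> x)"
          unfolding cdf_def by (subst measure_distr) (auto intro!: arg_cong[of _ _ "measure _"])
        also have "\<dots> = avg w (m n) (s n) (\<lambda>ys. of_bool (real (count_list ys d) \<le> x))"
          using prob_num_outdeg_bgw_cond[of "k n" n \<mu> "\<lambda>j. real j \<le> x" d] good assms(1)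
          by (simp add: w m_def s_def)
        also have "(\<lambda>ys. of_bool (real (count_list ys d) \<le> x) :: real)
            = (\<lambda>ys. \<Sum>j | real j \<le> x. of_bool (count_list ys d = j))"
          using fin by (simp add: fun_eq_iff of_bool_def)
        also have "avg w (m n) (s n) \<dots> = (\<Sum>j | real j \<le> x. avg w (m n) (s n) (\<lambda>ys. of_bool (count_list ys d = j)))"
          by (rule avg_sum)
        finally show "cdf (distr (bgw_cond \<mu> n (k n)) borel (\<lambda>\<omega>. real (num_outdeg (d + 1) (bgw_tree \<omega>)))) x
          = (\<Sum>j | real j \<le> x. avg w (m n) (s n) (\<lambda>ys. of_bool (count_list ys d = j)))" .
      qed
    qed
  }

  {
    fix p :: real
    assume inf: "filterlim (\<lambda>n. real (k n) ^ d / real n ^ (d - 1)) at_top sequentially" and p: "p \<ge> 1"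
    \<comment> \<open>The vanishing of the normalisation makes the lower-order terms of the moments
      disappear, so the limit is a constant.\<close>
    have c: "(\<lambda>n. real n ^ (d - 1) / real (k n) ^ d) \<longlonglongrightarrow> 0"
      using tendsto_inverse_0_at_top[OF inf] by simp
    have "(\<lambda>n. avg w (m n) (s n) (\<lambda>ys. \<bar>real n ^ (d - 1) / real (k n) ^ d * real (count_list ys d) - L\<bar> powr p)) \<longlonglongrightarrow> 0"
      using good p by (intro tendsto_Lp moments c) (auto elim: eventually_mono)
    then have lim: "(\<lambda>n. ennreal (avg w (m n) (s n)
        (\<lambda>ys. \<bar>real n ^ (d - 1) / real (k n) ^ d * real (count_list ys d) - L\<bar> powr p))) \<longlonglongrightarrow> ennreal 0"
      by (rule tendsto_ennrealI)
    have L': "pmf \<mu> 1 ^ (d - 1) * pmf \<mu> (d + 1) / pmf \<mu> 2 ^ d = L" by (simp add: L)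
    show "(\<lambda>n. \<integral>\<^sup>+ \<omega>. ennreal
              (\<bar>real n ^ (d - 1) / real (k n) ^ d * real (num_outdeg (d + 1) (bgw_tree \<omega>))
                 - pmf \<mu> 1 ^ (d - 1) * pmf \<mu> (d + 1) / pmf \<mu> 2 ^ d\<bar> powr p)
            \<partial>bgw_cond \<mu> n (k n)) \<longlonglongrightarrow> 0"
      unfolding L'
    proof (rule Lim_transform_eventually[OF lim[unfolded ennreal_0]])
      show "eventually (\<lambda>n. ennreal (avg w (m n) (s n)
          (\<lambda>ys. \<bar>real n ^ (d - 1) / real (k n) ^ d * real (count_list ys d) - L\<bar> powr p))
          = (\<integral>\<^sup>+ \<omega>. ennreal (\<bar>real n ^ (d - 1) / real (k n) ^ d * real (num_outdeg (d + 1) (bgw_tree \<omega>)) - L\<bar> powr p)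
            \<partial>bgw_cond \<mu> n (k n))) sequentially"
        using good
      proof eventually_elim
        case (elim n)
        then show ?case
          using nn_integral_num_outdeg_bgw_cond[of "k n" n \<mu>
              "\<lambda>j. \<bar>real n ^ (d - 1) / real (k n) ^ d * real j - L\<bar> powr p" d] assms(1)
          by (simp add: w m_def s_def)
      qed
    qed
  }
qed

end
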